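(* Let $E$ be a real uniformly smooth and 2-uniformly convex Banach space with dual $E^*$, and let $C$ be a nonempty closed convex subset of $E$. Let $A_1,\dots,A_M : C\to E^*$ be mappings and $\alpha>0$ a constant such that for each $i$: (V1) $A_i$ is $\alpha$-inverse strongly monotone; (V2) $VI(A_i,C)\neq\emptyset$; (V3) $\|A_iy\|\le\|A_iy-A_iu\|$ for all $y\in C$ and $u\in VI(A_i,C)$. Let $f_1,\dots,f_K: C\times C\to\mathbb{R}$ be bifunctions such that for each $k$: (A1) $f_k(x,x)=0$ for all $x\in C$; (A2) $f_k(x,y)+f_k(y,x)\le 0$ for all $x,y\in C$; (A3) $\limsup_{t\to0^+}f_k(tz+(1-t)x,y)\le f_k(x,y)$ for all $x,y,z\in C$; (A4) for each $x\in C$, $f_k(x,\cdot)$ is convex and lower semicontinuous. Let $S_1,\dots,S_N: C\to C$ be uniformly $L$-Lipschitz continuous (for a common $L>0$) and quasi $\phi$-asymptotically nonexpansive with the same sequence $\{k_n\}\subset[1,+\infty)$, $k_n\to1$. Put $$F=\Big(\bigcap_{i=1}^M VI(A_i,C)\Big)\cap\Big(\bigcap_{j=1}^N F(S_j)\Big)\cap\Big(\bigcap_{k=1}^K EP(f_k)\Big).$$ Assume $F\ne\emptyset$ and that there is $\omega>0$ with $F\subset\{u\in C:\|u\|\le\omega\}$. Let $\{\alpha_n\},\{\lambda_n\},\{r_n\}$ be real sequences with $$0\le\alpha_n\le1,\quad \limsup_{n\to\infty}\alpha_n<1,\quad \lambda_n\in[a,b],\quad r_n\ge d$$ for some $a,b\in(0,\alpha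 c^2/2)$ and $d>0$, where $1/c$ is the 2-uniform convexity constant of $E$. Let $x_0\in C$ be arbitrary, $C_0=C$, and for $n\ge0$ define $$\begin{aligned} &y_n^i=\Pi_C\big(J^{-1}(Jx_n-\lambda_nA_ix_n)\big),\quad i=1,\dots,M,\\ &i_n\in\arg\max\{\|y_n^i-x_n\|:1\le i\le M\},\quad \bar y_n=y_n^{i_n},\\ &z_n^j=J^{-1}\big(\alpha_nJx_n+(1-\alpha_n)JS_j^n\bar y_n\big),\quad j=1,\dots,N,\\ &j_n\in\arg\max\{\|z_n^j-x_n\|:1\le j\le N\},\quad \bar z_n=z_n^{j_n},\\ &u_n^k=T_{r_n}^k\bar z_n,\quad k=1,\dots,K,\\ &\ell_n\in\arg\max\{\|u_n^k-x_n\|:1\le k\le K\},\quad \bar u_n=u_n^{\ell_n},\\ &C_{n+1}=\{z\in C_n:\phi(z,\bar u_n)\le\phi(z,\bar z_n)\le\phi(z,x_n)+\epsilon_n\},\\ &x_{n+1}=\Pi_{C_{n+1}}x_0, \end{aligned}$$ where $\epsilon_n=(k_n-1)(\omega+\|x_n\|)^2$. Then $\{x_n\}$ converges strongly to $\Pi_Fx_0$.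
   Context: $J:E\to E^*$ is the normalized duality mapping, $\langle Jx,x\rangle=\|x\|^2=\|Jx\|^2$ (single-valued and bijective here). The 2-uniform convexity constant $1/c$ of $E$: $c$ is the best (largest) constant in $(0,1]$ such that $\|x-y\|\le\frac{2}{c^2}\|Jx-Jy\|$ for all $x,y\in E$. Lyapunov functional: $\phi(x,y)=\|x\|^2-2\langle x,Jy\rangle+\|y\|^2$ for $x,y\in E$. For a nonempty closed convex $D\subset E$, the generalized projection $\Pi_D:E\to D$ is $\Pi_D(x)=\arg\min_{y\in D}\phi(y,x)$ (the unique minimizer). For $A:C\to E^*$: $A$ is $\alpha$-inverse strongly monotone if $\langle Ax-Ay,x-y\rangle\ge\alpha\|Ax-Ay\|^2$ for all $x,y\in C$; $VI(A,C)=\{p^*\in C:\langle Ap^*,p-p^*\rangle\ge0\ \forall p\in C\}$. For $f:C\times C\to\mathbb{R}$: $EP(f)=\{\hat x\in C: f(\hat x,y)\ge0\ \forall y\in C\}$. For $r>0$ and $x\in E$, $T_r^kx$ denotes the unique $z\in C$ with $f_k(z,y)+\frac1r\langle y-z,Jz-Jx\rangle\ge0$ for all $y\in C$ (existence and uniqueness hold under (A1)-(A4)). For $T:C\to C$: $F(T)$ is the fixed point set. $T$ is uniformly $L$-Lipschitz continuous if $\|T^nx-T^ny\|\le L\|x-y\|$ for all $n\ge1$, $x,y\in C$. $T$ is quasi $\phi$-asymptotically nonexpansive with sequence $\{k_n\}\subset[1,\infty)$, $k_n\to1$, if $F(T)\neq\emptyset$ and $\phi(p,T^nx)\le k_n\phi(p,x)$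 for all $n\ge1$, $p\in F(T)$, $x\in C$. Convention: $S_j^0$ is the identity and $k_0\in[1,\infty)$ is any number. Ties in the $\arg\max$ are broken arbitrarily. *)

theory Defs
  imports "HOL-Analysis.Analysis"
begin

text \<open>The dual of a real normed space \<open>'a\<close> is the space \<open>'a \<Rightarrow>\<^sub>L real\<close> of bounded linear functionals
  with the operator norm; the pairing of \<open>f\<close> and \<open>x\<close> is \<open>blinfun_apply f x\<close>. Mappings on \<open>C\<close> are total
  functions of which only the values on \<open>C\<close> matter.\<close>

definition modulus_of_convexity :: "'a::real_normed_vector itself \<Rightarrow> real \<Rightarrow> real" where
  "modulus_of_convexity _ \<epsilon> =
     Inf {1 - norm ((1/2) *\<^sub>R (x + y)) | x y :: 'a. norm x = 1 \<and> norm y = 1 \<and> norm (x - y) \<ge> \<epsilon>}"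

definition modulus_of_smoothness :: "'a::real_normed_vector itself \<Rightarrow> real \<Rightarrow> real" where
  "modulus_of_smoothness _ t =
     Sup {(norm (x + y) + norm (x - y)) / 2 - 1 | x y :: 'a. norm x = 1 \<and> norm y = t}"

definition two_uniformly_convex :: "'a::real_normed_vector itself \<Rightarrow> bool" where
  "two_uniformly_convex E \<longleftrightarrow>
     (\<exists>\<kappa>>0. \<forall>\<epsilon>. 0 < \<epsilon> \<and> \<epsilon> \<le> 2 \<longrightarrow> modulus_of_convexity E \<epsilon> \<ge> \<kappa> * \<epsilon>\<^sup>2)"

definition uniformly_smooth :: "'a::real_normed_vector itself \<Rightarrow> bool" where
  "uniformly_smooth E \<longleftrightarrow> ((\<lambda>t. modulus_of_smoothness E t / t) \<longlongrightarrow> 0) (at_right 0)"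

text \<open>The normalized duality mapping is set-valued in general. It is single-valued on uniformly smooth
  spaces, and moreover bijective if the space is also uniformly convex and complete. Under these
  conditions the definite description below and its inverse are meaningful.\<close>

definition duality_map :: "'a::real_normed_vector \<Rightarrow> ('a \<Rightarrow>\<^sub>L real)" where
  "duality_map x = (THE f. blinfun_apply f x = (norm x)\<^sup>2 \<and> (norm f)\<^sup>2 = (norm x)\<^sup>2)"

abbreviation duality_map_inv :: "('a::real_normed_vector \<Rightarrow>\<^sub>L real) \<Rightarrow> 'a" where
  "duality_map_inv \<equiv> inv duality_map"

text \<open>The constant \<open>c\<close>; its reciprocal is the 2-uniform convexity constant of the space.\<close>

definition two_uc_c :: "'a::real_normed_vector itself \<Rightarrow> real" where
  "two_uc_c _ = (GREATEST c. 0 < c \<and> c \<le> 1 \<and>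
     (\<forall>x y :: 'a. norm (x - y) \<le> 2 / c\<^sup>2 * norm (duality_map x - duality_map y)))"

definition lyapunov :: "'a::real_normed_vector \<Rightarrow> 'a \<Rightarrow> real" where
  "lyapunov x y = (norm x)\<^sup>2 - 2 * blinfun_apply (duality_map y) x + (norm y)\<^sup>2"

definition gen_proj :: "'a::real_normed_vector set \<Rightarrow> 'a \<Rightarrow> 'a" where
  "gen_proj D x = arg_min_on (\<lambda>y. lyapunov y x) D"

definition inverse_strongly_monotone ::
  "'a::real_normed_vector set \<Rightarrow> real \<Rightarrow> ('a \<Rightarrow> ('a \<Rightarrow>\<^sub>L real)) \<Rightarrow> bool" where
  "inverse_strongly_monotone C \<alpha> A \<longleftrightarrow>
     (\<forall>x\<in>C. \<forall>y\<in>C. blinfun_apply (A x - A y) (x - y) \<ge> \<alpha> * (norm (A x - A y))\<^sup>2)"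

definition VI :: "('a::real_normed_vector \<Rightarrow> ('a \<Rightarrow>\<^sub>L real)) \<Rightarrow> 'a set \<Rightarrow> 'a set" where
  "VI A C = {q \<in> C. \<forall>p\<in>C. blinfun_apply (A q) (p - q) \<ge> 0}"

definition EP :: "'a set \<Rightarrow> ('a \<Rightarrow> 'a \<Rightarrow> real) \<Rightarrow> 'a set" where
  "EP C f = {x \<in> C. \<forall>y\<in>C. f x y \<ge> 0}"

definition lsc_on :: "'a::topological_space set \<Rightarrow> ('a \<Rightarrow> real) \<Rightarrow> bool" where
  "lsc_on C g \<longleftrightarrow> (\<forall>y\<in>C. ereal (g y) \<le> Liminf (at y within C) (\<lambda>z. ereal (g z)))"

definition resolvent ::
  "'a::real_normed_vector set \<Rightarrow> ('a \<Rightarrow> 'a \<Rightarrow> real) \<Rightarrow> real \<Rightarrow> 'a \<Rightarrow> 'a" where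
  "resolvent C f r x = (THE z. z \<in> C \<and>
     (\<forall>y\<in>C. f z y + 1 / r * blinfun_apply (duality_map z - duality_map x) (y - z) \<ge> 0))"

definition fixed_points :: "'a set \<Rightarrow> ('a \<Rightarrow> 'a) \<Rightarrow> 'a set" where
  "fixed_points C T = {x \<in> C. T x = x}"

definition uniformly_lipschitz_on :: "'a::metric_space set \<Rightarrow> real \<Rightarrow> ('a \<Rightarrow> 'a) \<Rightarrow> bool" where
  "uniformly_lipschitz_on C L T \<longleftrightarrow> (\<forall>n\<ge>1. L-lipschitz_on C (T ^^ n))"

definition quasi_phi_asymp_nonexpansive ::
  "'a::real_normed_vector set \<Rightarrow> (nat \<Rightarrow> real) \<Rightarrow> ('a \<Rightarrow> 'a) \<Rightarrow> bool" where
  "quasi_phi_asymp_nonexpansive C k T \<longleftrightarrow>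
     (\<forall>n\<ge>1. k n \<ge> 1) \<and> k \<longlonglongrightarrow> 1 \<and> fixed_points C T \<noteq> {} \<and>
     (\<forall>n\<ge>1. \<forall>p\<in>fixed_points C T. \<forall>x\<in>C. lyapunov p ((T ^^ n) x) \<le> k n * lyapunov p x)"

end

theory Submission
  imports Defs
begin

text \<open>The sets \<open>Cs n\<close> decrease and contain \<open>F\<close>, so the Pythagorean inequality of the generalized projection
  makes \<open>lyapunov (x n) (x 0)\<close> increasing and bounded and gives
  \<open>lyapunov (x n) (x m) \<le> lyapunov (x n) (x 0) - lyapunov (x m) (x 0)\<close>. By 2-uniform convexity \<open>lyapunov v w\<close>
  dominates a multiple of \<open>(norm (v - w))\<^sup>2\<close>; hence \<open>x\<close> is Cauchy, without any appeal to weak topology. Membership of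
  \<open>x (Suc n)\<close> in \<open>Cs (Suc n)\<close> forces \<open>zbar\<close> and \<open>ubar\<close> to the same limit \<open>p\<close>. The decrease
  \<open>lyapunov q (ybar n) \<le> lyapunov q (x n) - \<kappa> * (norm (A (im n) (x n)))\<^sup>2\<close> for \<open>q\<close> in \<open>F\<close> then forces \<open>ybar\<close> to \<open>p\<close> too,
  and the maximality of the indices carries this over to all \<open>y\<close>, \<open>z\<close>, \<open>u\<close>, so that \<open>p\<close> lies in \<open>F\<close>.

  Existence of the resolvents, usually obtained from the KKM lemma and weak compactness, follows here from an
  elementary theorem of the alternative for convex functions, the finite intersection property of closed
  convex sets (minimal norm points form Cauchy sequences) and Minty's argument.\<close>

section \<open>The duality mapping of a smooth space\<close>

text \<open>The notions are fixed by description and choice operators, so everything rests on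
  witnesses: existence and uniqueness for \<open>duality_map\<close> and \<open>resolvent\<close>,
  an attained maximum for \<open>two_uc_c\<close>, minimizers for \<open>gen_proj\<close>. Existence
  of minimizers and resolvents goes back to one inequality, 2-uniform convexity rewritten as a
  quantitative midpoint inequality for squared norms.

  The bound \<open>b < \<alpha> * c\<^sup>2 / 2\<close> is a balance. Inverse strong monotonicity
  gains \<open>\<alpha> * (norm (A i (x n)))\<^sup>2\<close>, while the displacement of the step
  costs at most \<open>2 / c\<^sup>2 * lams n\<close> times the same square. The square is the same
  because (V3) replaces a difference of values of \<open>A i\<close> by the value at
  \<open>x n\<close>.

  The iterates \<open>S j ^^ n\<close> may increase the Lyapunov distance from a point of
  \<open>F\<close> by the factor \<open>ks n\<close>. That point is unknown, so
  \<open>\<epsilon>s n\<close> bounds the excess uniformly over \<open>F\<close> by means of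
  \<open>\<omega>\<close>; this is why every \<open>Cs n\<close> keeps all of
  \<open>F\<close>.\<close>

lemma norm_square_convex:
  fixes x y :: "'a::real_normed_vector"
  assumes "0 \<le> l" "l \<le> 1"
  shows "(norm ((1 - l) *\<^sub>R x + l *\<^sub>R y))\<^sup>2 \<le> (1 - l) * (norm x)\<^sup>2 + l * (norm y)\<^sup>2"
proof -
  have "norm ((1 - l) *\<^sub>R x + l *\<^sub>R y) \<le> (1 - l) * norm x + l * norm y"
    using norm_triangle_ineq[of "(1 - l) *\<^sub>R x" "l *\<^sub>R y"] assms by simp
  then have "(norm ((1 - l) *\<^sub>R x + l *\<^sub>R y))\<^sup>2 \<le> ((1 - l) * norm x + l * norm y)\<^sup>2"
    by (simp add: power_mono)
  also have "\<dots> = (1 - l) * (norm x)\<^sup>2 + l * (norm y)\<^sup>2 - (1 - l) * l * (norm x - norm y)\<^sup>2"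
    by algebra
  also have "\<dots> \<le> (1 - l) * (norm x)\<^sup>2 + l * (norm y)\<^sup>2"
    using assms by simp
  finally show ?thesis .
qed

text \<open>The difference quotient of half the squared norm. With the half, its limit at
  \<open>0\<close> is the duality mapping without a factor 2.\<close>

definition sq_quot :: "'a::real_normed_vector \<Rightarrow> 'a \<Rightarrow> real \<Rightarrow> real" where
  "sq_quot x h t = ((norm (x + t *\<^sub>R h))\<^sup>2 - (norm x)\<^sup>2) / (2 * t)"

text \<open>Slopes of a convex function from a fixed point grow with the step, so the one-sided
  derivative is an infimum and may be estimated at any single step.\<close>

lemma sq_quot_mono:
  assumes "0 < s" "s \<le> t"
  shows "sq_quot x h s \<le> sq_quot x h t"
proof -
  define l where "l = s / t"
  have l: "0 \<le> l" "l \<le> 1" "s = l * t" "0 < l" "0 < t"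
    using assms by (auto simp: l_def)
  have eq: "x + s *\<^sub>R h = (1 - l) *\<^sub>R x + l *\<^sub>R (x + t *\<^sub>R h)"
    by (simp add: l(3) algebra_simps)
  have "(norm (x + s *\<^sub>R h))\<^sup>2 - (norm x)\<^sup>2
      \<le> l * ((norm (x + t *\<^sub>R h))\<^sup>2 - (norm x)\<^sup>2)"
    using norm_square_convex[OF l(1,2), of x "x + t *\<^sub>R h", folded eq] by (simp add: algebra_simps)
  then have "sq_quot x h s \<le> (l * ((norm (x + t *\<^sub>R h))\<^sup>2 - (norm x)\<^sup>2)) / (2 * s)"
    unfolding sq_quot_def using assms by (intro divide_right_mono) auto
  also have "\<dots> = sq_quot x h t"
    unfolding sq_quot_def l(3) using l by simp
  finally show ?thesis .
qed

lemma sq_quot_le: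
  assumes "0 < t"
  shows "sq_quot x h t \<le> norm x * norm h + t * (norm h)\<^sup>2 / 2"
proof -
  have "norm (x + t *\<^sub>R h) \<le> norm x + t * norm h"
    using norm_triangle_ineq[of x "t *\<^sub>R h"] assms by simp
  then have "(norm (x + t *\<^sub>R h))\<^sup>2 - (norm x)\<^sup>2 \<le> (norm x + t * norm h)\<^sup>2 - (norm x)\<^sup>2"
    by (simp add: power_mono)
  also have "\<dots> = (norm x * norm h + t * (norm h)\<^sup>2 / 2) * (2 * t)"
    by (simp add: power2_eq_square algebra_simps)
  finally show ?thesis
    unfolding sq_quot_def using assms by (simp add: pos_divide_le_eq)
qed

lemma sq_quot_ge:
  assumes "0 < t"
  shows "sq_quot x h t \<ge> - (norm x * norm h)"
\<comment> \<open>The reverse triangle inequality can be squared only while its lower bound is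
  nonnegative; for long steps it suffices to drop the first square.\<close>
proof (cases "norm x \<le> t * norm h")
  case True
  have "(norm x)\<^sup>2 \<le> norm x * (t * norm h)"
    using True by (simp add: power2_eq_square mult_left_mono)
  moreover have "0 \<le> norm x * (t * norm h)" using assms by simp
  moreover have "- (norm x * norm h) * (2 * t) = - 2 * (norm x * (t * norm h))" by simp
  ultimately have "- (norm x * norm h) * (2 * t) \<le> (norm (x + t *\<^sub>R h))\<^sup>2 - (norm x)\<^sup>2"
    using zero_le_power2[of "norm (x + t *\<^sub>R h)"] by linarith
  then show ?thesis
    unfolding sq_quot_def using assms by (simp add: pos_le_divide_eq)
next
  case False
  have "norm x - t * norm h \<le> norm (x + t *\<^sub>R h)"
    using norm_triangle_ineq2[of x "- t *\<^sub>R h"] assms by simp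
  then have "(norm x - t * norm h)\<^sup>2 \<le> (norm (x + t *\<^sub>R h))\<^sup>2"
    using False by (intro power_mono) auto
  moreover have "(norm x - t * norm h)\<^sup>2 \<ge> (norm x)\<^sup>2 - norm x * norm h * (2 * t)"
    using zero_le_power2[of "t * norm h"] by (simp add: power2_diff algebra_simps)
  ultimately have "- (norm x * norm h) * (2 * t) \<le> (norm (x + t *\<^sub>R h))\<^sup>2 - (norm x)\<^sup>2"
    by simp
  then show ?thesis
    unfolding sq_quot_def using assms by (simp add: pos_le_divide_eq)
qed

text \<open>The midpoint of \<open>x + t *\<^sub>R h\<close> and \<open>x + t *\<^sub>R k\<close> is
  a half step in direction \<open>h + k\<close>; halving the step is harmless under an infimum over
  all steps.\<close>

lemma sq_quot_add:
  assumes "0 < t"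
  shows "sq_quot x (h + k) (t / 2) \<le> sq_quot x h t + sq_quot x k t"
proof -
  have "x + (t / 2) *\<^sub>R (h + k) = (1 - 1/2) *\<^sub>R (x + t *\<^sub>R h) + (1/2) *\<^sub>R (x + t *\<^sub>R k)"
    by (simp add: algebra_simps flip: scaleR_add_left)
  then have "(norm (x + (t / 2) *\<^sub>R (h + k)))\<^sup>2
      \<le> (norm (x + t *\<^sub>R h))\<^sup>2 / 2 + (norm (x + t *\<^sub>R k))\<^sup>2 / 2"
    using norm_square_convex[of "1/2" "x + t *\<^sub>R h" "x + t *\<^sub>R k"] by simp
  then show ?thesis
    unfolding sq_quot_def using assms by (simp add: divide_simps)
qed

lemma sq_quot_scale:
  assumes "0 < s"
  shows "sq_quot x (s *\<^sub>R h) t = s * sq_quot x h (s * t)"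
  using assms by (simp add: sq_quot_def mult.commute)

text \<open>The one-sided directional derivative of \<open>(norm x)\<^sup>2 / 2\<close>. It is sublinear for every norm and linear for
  smooth ones, which yields the duality mapping without the Hahn--Banach theorem.\<close>

definition sq_deriv :: "'a::real_normed_vector \<Rightarrow> 'a \<Rightarrow> real" where
  "sq_deriv x h = (INF t\<in>{0<..}. sq_quot x h t)"

lemma sq_deriv_le: "0 < t \<Longrightarrow> sq_deriv x h \<le> sq_quot x h t"
  unfolding sq_deriv_def
  by (rule cINF_lower) (auto intro!: bdd_belowI[where m = "- (norm x * norm h)"] sq_quot_ge)

lemma sq_deriv_ge: "(\<And>t. 0 < t \<Longrightarrow> g \<le> sq_quot x h t) \<Longrightarrow> g \<le> sq_deriv x h"
  unfolding sq_deriv_def by (rule cINF_greatest) auto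

lemma sq_deriv_add: "sq_deriv x (h + k) \<le> sq_deriv x h + sq_deriv x k"
proof -
  have *: "sq_deriv x (h + k) \<le> sq_quot x h t + sq_quot x k s" if "0 < t" "0 < s" for t s
  proof -
    \<comment> \<open>The two infima are approached at unrelated steps; monotonicity lets
      \<open>min t s\<close> replace both.\<close>
    have "sq_deriv x (h + k) \<le> sq_quot x (h + k) (min t s / 2)"
      using that by (intro sq_deriv_le) auto
    also have "\<dots> \<le> sq_quot x h (min t s) + sq_quot x k (min t s)"
      using that by (intro sq_quot_add) auto
    also have "\<dots> \<le> sq_quot x h t + sq_quot x k s"
      using that by (intro add_mono sq_quot_mono) auto
    finally show ?thesis .
  qed
  have "sq_deriv x (h + k) - sq_quot x k s \<le> sq_deriv x h" if "0 < s" for s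
    using *[OF _ that] by (intro sq_deriv_ge) (simp add: algebra_simps)
  then have "sq_deriv x (h + k) - sq_deriv x h \<le> sq_deriv x k"
    by (intro sq_deriv_ge) (simp add: algebra_simps)
  then show ?thesis by simp
qed

lemma sq_deriv_scale:
  assumes "0 < s"
  shows "sq_deriv x (s *\<^sub>R h) = s * sq_deriv x h"
proof (rule antisym)
  have "sq_deriv x (s *\<^sub>R h) / s \<le> sq_deriv x h"
  proof (rule sq_deriv_ge)
    fix t :: real assume "0 < t"
    then show "sq_deriv x (s *\<^sub>R h) / s \<le> sq_quot x h t"
      using sq_deriv_le[of "t / s" x "s *\<^sub>R h"] sq_quot_scale[OF assms, of x h "t / s"] assms
      by (simp add: field_simps)
  qed
  then show "sq_deriv x (s *\<^sub>R h) \<le> s * sq_deriv x h"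
    using assms by (simp add: field_simps)
  show "s * sq_deriv x h \<le> sq_deriv x (s *\<^sub>R h)"
    using assms by (intro sq_deriv_ge) (simp add: sq_quot_scale sq_deriv_le)
qed

lemma sq_deriv_le_norm: "sq_deriv x h \<le> norm x * norm h"
proof (rule field_le_epsilon)
  fix e :: real assume e: "0 < e"
  \<comment> \<open>Chosen to make the quadratic remainder at most \<open>e\<close>; the
    \<open>+ 1\<close> covers \<open>h = 0\<close>.\<close>
  define t where "t = 2 * e / ((norm h)\<^sup>2 + 1)"
  have h: "0 < (norm h)\<^sup>2 + 1" by (simp add: add_nonneg_pos)
  have t: "0 < t" using e h by (simp add: t_def)
  have "t * (norm h)\<^sup>2 / 2 \<le> e"
    unfolding t_def using e h by (simp add: field_simps)
  then show "sq_deriv x h \<le> norm x * norm h + e"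
    using sq_deriv_le[OF t, of x h] sq_quot_le[OF t, of x h] by simp
qed

lemma uniformly_smooth_near_unit:
  assumes "uniformly_smooth TYPE('a::real_normed_vector)" "0 < \<eta>"
  shows "\<exists>\<delta>>0. \<forall>t. 0 < t \<and> t < \<delta> \<longrightarrow>
     (\<forall>x h :: 'a. norm x = 1 \<and> norm h = t \<longrightarrow> norm (x + h) + norm (x - h) \<le> 2 + \<eta> * t)"
proof -
  have "\<forall>\<^sub>F t in at_right 0. modulus_of_smoothness TYPE('a) t / t < \<eta> / 2"
    using assms unfolding uniformly_smooth_def by (intro order_tendstoD(2)[where y = 0]) auto
  then obtain \<delta> where \<delta>: "\<delta> > 0" "\<And>t. 0 < t \<Longrightarrow> t < \<delta> \<Longrightarrow> modulus_of_smoothness TYPE('a) t / t < \<eta> / 2"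
    unfolding eventually_at_right_field by auto
  have "norm (x + h) + norm (x - h) \<le> 2 + \<eta> * t"
    if t: "0 < t" "t < \<delta>" and x: "norm x = 1" and h: "norm h = t" for t and x h :: 'a
  proof -
    let ?S = "{(norm (x + y) + norm (x - y)) / 2 - 1 | x y :: 'a. norm x = 1 \<and> norm y = t}"
    have "bdd_above ?S"
    proof (rule bdd_aboveI)
      fix s assume "s \<in> ?S"
      then obtain x y :: 'a where "s = (norm (x + y) + norm (x - y)) / 2 - 1" "norm x = 1" "norm y = t"
        by auto
      then show "s \<le> t"
        using norm_triangle_ineq[of x y] norm_triangle_ineq4[of x y] by argo
    qed
    then have "(norm (x + h) + norm (x - h)) / 2 - 1 \<le> modulus_of_smoothness TYPE('a) t"
      unfolding modulus_of_smoothness_def using x h by (intro cSup_upper) auto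
    moreover have "modulus_of_smoothness TYPE('a) t < \<eta> / 2 * t"
      using \<delta>(2)[OF t] t by (simp add: pos_divide_less_eq)
    ultimately show ?thesis by argo
  qed
  with \<delta>(1) show ?thesis by blast
qed

text \<open>Normalizing \<open>x\<close> and expanding squares around \<open>norm x\<close> carries
  smoothness from the unit sphere to a second difference of the squared norm. Half of
  \<open>\<eta>\<close> pays for the first-order term, hence \<open>\<eta> / (4 * r)\<close>, and
  half for the remainder, hence \<open>norm h < \<eta> / 4\<close>.\<close>

lemma uniformly_smooth_near:
  fixes x :: "'a::real_normed_vector"
  assumes sm: "uniformly_smooth TYPE('a)" and "0 < \<eta>"
  shows "\<exists>\<delta>>0. \<forall>h. norm h < \<delta> \<longrightarrow> (norm (x + h))\<^sup>2 + (norm (x - h))\<^sup>2 \<le> 2 * (norm x)\<^sup>2 + \<eta> * norm h"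
proof (cases "x = 0")
  case True
  have "(norm (x + h))\<^sup>2 + (norm (x - h))\<^sup>2 \<le> 2 * (norm x)\<^sup>2 + \<eta> * norm h" if "norm h < \<eta> / 2" for h
    using that True mult_right_mono[of "2 * norm h" \<eta> "norm h"] by (simp add: power2_eq_square)
  then show ?thesis using assms(2) by (intro exI[of _ "\<eta> / 2"]) auto
next
  case False
  define r where "r = norm x"
  have r: "0 < r" using False by (simp add: r_def)
  obtain \<delta> where \<delta>: "\<delta> > 0" "\<And>t x h. 0 < t \<Longrightarrow> t < \<delta> \<Longrightarrow> norm x = 1 \<Longrightarrow> norm (h::'a) = t \<Longrightarrow>
      norm (x + h) + norm (x - h) \<le> 2 + \<eta> / (4 * r) * t"
    using uniformly_smooth_near_unit[OF sm, of "\<eta> / (4 * r)"] assms(2) r by auto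
  have "(norm (x + h))\<^sup>2 + (norm (x - h))\<^sup>2 \<le> 2 * (norm x)\<^sup>2 + \<eta> * norm h"
    if h: "norm h < min (\<delta> * r) (\<eta> / 4)" for h
  proof (cases "h = 0")
    case False
    let ?x = "(1 / r) *\<^sub>R x" and ?h = "(1 / r) *\<^sub>R h"
    have "norm (?x + ?h) + norm (?x - ?h) \<le> 2 + \<eta> / (4 * r) * (norm h / r)"
      using False h r by (intro \<delta>(2)) (auto simp: r_def field_simps)
    moreover have "norm (?x + ?h) = norm (x + h) / r" "norm (?x - ?h) = norm (x - h) / r"
      using r by (simp_all flip: scaleR_add_right scaleR_diff_right)
    ultimately have "norm (x + h) / r + norm (x - h) / r \<le> 2 + \<eta> / (4 * r) * (norm h / r)"
      by simp
    then have *: "norm (x + h) + norm (x - h) \<le> 2 * r + \<eta> / (4 * r) * norm h"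
      using r mult_right_mono[of "norm (x + h) / r + norm (x - h) / r" "2 + \<eta> / (4 * r) * (norm h / r)" r]
      by (simp add: distrib_right)
    have sq: "s\<^sup>2 \<le> r\<^sup>2 + 2 * r * (s - r) + (norm h)\<^sup>2" if "\<bar>s - r\<bar> \<le> norm h" for s
    proof -
      have "(s - r)\<^sup>2 \<le> (norm h)\<^sup>2" using that by (metis abs_ge_zero power2_abs power_mono)
      then show ?thesis by (simp add: power2_eq_square algebra_simps)
    qed
    have "\<bar>norm (x + h) - r\<bar> \<le> norm h" "\<bar>norm (x - h) - r\<bar> \<le> norm h"
      using norm_triangle_ineq3[of "x + h" x] norm_triangle_ineq3[of "x - h" x] by (auto simp: r_def)
    from sq[OF this(1)] sq[OF this(2)]
    have "(norm (x + h))\<^sup>2 + (norm (x - h))\<^sup>2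
      \<le> 2 * r\<^sup>2 + 2 * r * (norm (x + h) + norm (x - h) - 2 * r) + 2 * (norm h)\<^sup>2"
      by (simp add: algebra_simps)
    also have "2 * r * (norm (x + h) + norm (x - h) - 2 * r) \<le> 2 * r * (\<eta> / (4 * r) * norm h)"
      using * r by (intro mult_left_mono) auto
    also have "2 * r * (\<eta> / (4 * r) * norm h) = \<eta> / 2 * norm h"
      using r by simp
    also have "2 * (norm h)\<^sup>2 \<le> \<eta> / 2 * norm h"
      using h mult_right_mono[of "norm h" "\<eta> / 4" "norm h"] by (simp add: power2_eq_square)
    finally show ?thesis by (simp add: r_def)
  qed simp
  then show ?thesis
    using \<delta>(1) r assms(2) by (intro exI[of _ "min (\<delta> * r) (\<eta> / 4)"]) auto
qed

text \<open>Every candidate value of the duality mapping at \<open>x\<close> is a subgradient of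
  half the squared norm there.\<close>

lemma blinfun_le_sq_quot:
  assumes "blinfun_apply g x = (norm x)\<^sup>2" "norm g = norm x" "0 < t"
  shows "blinfun_apply g h \<le> sq_quot x h t"
proof -
  have "blinfun_apply g (x + t *\<^sub>R h) \<le> norm x * norm (x + t *\<^sub>R h)"
    using norm_blinfun[of g "x + t *\<^sub>R h"] assms(2) by simp
  also have "\<dots> \<le> ((norm x)\<^sup>2 + (norm (x + t *\<^sub>R h))\<^sup>2) / 2"
    using zero_le_power2[of "norm x - norm (x + t *\<^sub>R h)"]
    unfolding power2_diff by simp
  finally have "t * blinfun_apply g h * 2 \<le> (norm (x + t *\<^sub>R h))\<^sup>2 - (norm x)\<^sup>2"
    using assms(1) by (simp add: blinfun.add_right blinfun.scaleR_right)
  then show ?thesis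
    unfolding sq_quot_def using assms(3) by (simp add: field_simps)
qed

section \<open>Single-valuedness and continuity of the duality mapping\<close>

context
  assumes smooth: "uniformly_smooth TYPE('a::real_normed_vector)"
begin

text \<open>Smoothness makes the left and right derivatives agree: opposite quotients add up to a
  second difference, which is of smaller order than the step. An odd sublinear function is
  linear.\<close>

lemma sq_deriv_minus: "sq_deriv (x :: 'a) (- h) = - sq_deriv x h"
proof (rule antisym)
  show "sq_deriv x (- h) \<le> - sq_deriv x h"
  proof (rule field_le_epsilon)
    fix e :: real assume "0 < e"
    define \<eta> where "\<eta> = e / (norm h + 1)"
    have \<eta>: "0 < \<eta>" "\<eta> * norm h \<le> e"
      using \<open>0 < e\<close> add_nonneg_pos[OF norm_ge_zero[of h] zero_less_one]
      by (auto simp: \<eta>_def pos_divide_le_eq algebra_simps)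
    obtain \<delta> where \<delta>: "\<delta> > 0" "\<And>h. norm h < \<delta> \<Longrightarrow>
        (norm (x + h))\<^sup>2 + (norm (x - h))\<^sup>2 \<le> 2 * (norm x)\<^sup>2 + \<eta> * norm h"
      using uniformly_smooth_near[OF smooth \<eta>(1), of x] by auto
    define t where "t = \<delta> / (norm h + 1)"
    have nh: "0 < norm h + 1" by (simp add: add_nonneg_pos)
    have t: "0 < t" "norm (t *\<^sub>R h) < \<delta>"
      using \<delta>(1) nh by (auto simp: t_def field_simps)
    have "sq_quot x h t + sq_quot x (- h) t
        = ((norm (x + t *\<^sub>R h))\<^sup>2 + (norm (x - t *\<^sub>R h))\<^sup>2 - 2 * (norm x)\<^sup>2) / (2 * t)"
      using t unfolding sq_quot_def by (simp add: field_simps)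
    also have "\<dots> \<le> (\<eta> * (t * norm h)) / (2 * t)"
      using \<delta>(2)[OF t(2)] t(1) by (intro divide_right_mono) auto
    also have "\<dots> \<le> e" using t \<eta>(2) \<open>0 < e\<close> by simp
    finally show "sq_deriv x (- h) \<le> - sq_deriv x h + e"
      using sq_deriv_le[OF t(1), of x h] sq_deriv_le[OF t(1), of x "- h"] by simp
  qed
  show "- sq_deriv x h \<le> sq_deriv x (- h)"
  proof -
    have "0 \<le> sq_deriv x 0"
      by (rule sq_deriv_ge) (simp add: sq_quot_def)
    then show ?thesis using sq_deriv_add[of x h "- h"] by simp
  qed
qed

lemma bounded_linear_sq_deriv: "bounded_linear (sq_deriv (x :: 'a))"
proof (rule bounded_linear_intro)
  fix h k :: 'a
  show "sq_deriv x (h + k) = sq_deriv x h + sq_deriv x k"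
    using sq_deriv_add[of x h k] sq_deriv_add[of x "- h" "- k"] sq_deriv_minus[of x "h + k"]
    by (simp add: sq_deriv_minus)
next
  fix r :: real and h :: 'a
  have z: "sq_deriv x 0 = 0" using sq_deriv_minus[of x 0] by simp
  consider "0 < r" | "r = 0" | "r < 0" by linarith
  then show "sq_deriv x (r *\<^sub>R h) = r *\<^sub>R sq_deriv x h"
  proof cases
    case 3
    then show ?thesis
      using sq_deriv_scale[of "- r" x h] sq_deriv_minus[of x "r *\<^sub>R h"] by simp
  qed (auto simp: z sq_deriv_scale)
next
  fix h :: 'a
  show "norm (sq_deriv x h) \<le> norm h * norm x"
    using sq_deriv_le_norm[of x h] sq_deriv_le_norm[of x "- h"]
    by (simp add: sq_deriv_minus mult.commute)
qed

text \<open>Each candidate lies below \<open>sq_deriv x\<close>; passing from \<open>h\<close> to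
  \<open>- h\<close> turns this into equality, so all candidates coincide.\<close>

lemma duality_map_eqI:
  assumes "blinfun_apply g (x :: 'a) = (norm x)\<^sup>2" "norm g = norm x"
  shows "duality_map x = g"
proof -
  have eq: "blinfun_apply g h = sq_deriv x h"
    if "blinfun_apply g (x :: 'a) = (norm x)\<^sup>2" "norm g = norm x" for g h
  proof -
    have "blinfun_apply g h \<le> sq_deriv x h" for h
      by (rule sq_deriv_ge) (rule blinfun_le_sq_quot[OF that])
    from this[of h] this[of "- h"] show ?thesis
      by (simp add: sq_deriv_minus blinfun.minus_right)
  qed
  show "duality_map x = g"
    unfolding duality_map_def
  proof (rule the_equality)
    fix g' assume "blinfun_apply g' x = (norm x)\<^sup>2 \<and> (norm g')\<^sup>2 = (norm x)\<^sup>2"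
    then have "blinfun_apply g' x = (norm x)\<^sup>2" "norm g' = norm x" by auto
    then show "g' = g" using eq assms by (intro blinfun_eqI) simp
  qed (use assms in auto)
qed

lemma sq_deriv_self: "sq_deriv (x :: 'a) x = (norm x)\<^sup>2"
proof (rule antisym)
  show "sq_deriv x x \<le> (norm x)\<^sup>2"
    using sq_deriv_le_norm[of x x] by (simp add: power2_eq_square)
  show "(norm x)\<^sup>2 \<le> sq_deriv x x"
  proof (rule sq_deriv_ge)
    fix t :: real assume t: "0 < t"
    have "x + t *\<^sub>R x = (1 + t) *\<^sub>R x" by (simp add: algebra_simps)
    then have "norm (x + t *\<^sub>R x) = (1 + t) * norm x" using t by simp
    then have "(norm (x + t *\<^sub>R x))\<^sup>2 - (norm x)\<^sup>2 = (norm x)\<^sup>2 * (2 * t) + t\<^sup>2 * (norm x)\<^sup>2"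
      using t by (simp add: power2_eq_square algebra_simps)
    then have "(norm x)\<^sup>2 * (2 * t) \<le> (norm (x + t *\<^sub>R x))\<^sup>2 - (norm x)\<^sup>2"
      by simp
    then show "(norm x)\<^sup>2 \<le> sq_quot x x t"
      unfolding sq_quot_def using t by (simp add: pos_le_divide_eq)
  qed
qed

lemma
  shows duality_map_self: "blinfun_apply (duality_map x) x = (norm (x :: 'a))\<^sup>2"
    and norm_duality_map: "norm (duality_map x) = norm (x :: 'a)"
    and duality_map_eq_sq_deriv: "blinfun_apply (duality_map x) h = sq_deriv x h"
proof -
  define g where "g = Blinfun (sq_deriv x)"
  have g: "blinfun_apply g h = sq_deriv x h" for h
    unfolding g_def by (simp add: bounded_linear_Blinfun_apply[OF bounded_linear_sq_deriv])
  have *: "blinfun_apply g x = (norm x)\<^sup>2" by (simp add: g sq_deriv_self)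
  moreover have "norm g = norm x"
  proof (rule antisym)
    show "norm g \<le> norm x"
      using bounded_linear_sq_deriv sq_deriv_le_norm[of x] sq_deriv_le_norm[of x "- h" for h]
      by (intro norm_blinfun_bound) (auto simp: g sq_deriv_minus abs_le_iff)
    show "norm x \<le> norm g"
      using norm_blinfun[of g x] * by (cases "x = 0") (auto simp: power2_eq_square)
  qed
  ultimately have "duality_map x = g" using duality_map_eqI by blast
  then show "blinfun_apply (duality_map x) x = (norm x)\<^sup>2" "norm (duality_map x) = norm x"
    "blinfun_apply (duality_map x) h = sq_deriv x h"
    using * \<open>norm g = norm x\<close> g by auto
qed

lemma duality_map_subgradient:
  "(norm (w :: 'a))\<^sup>2 \<ge> (norm v)\<^sup>2 + 2 * blinfun_apply (duality_map v) (w - v)"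
  using sq_deriv_le[of 1 v "w - v"]
  by (simp add: sq_quot_def duality_map_eq_sq_deriv)

text \<open>The subgradient inequalities at \<open>g n\<close> toward \<open>p + h\<close> and at
  \<open>p\<close> toward \<open>p - h\<close> add up to a bound by the second difference at
  \<open>p\<close>. Thus only smoothness at the limit point is used, and the convergence is in the
  dual norm.\<close>

lemma duality_map_tendsto:
  fixes p :: 'a
  assumes lim: "(g \<longlongrightarrow> p) G"
  shows "((\<lambda>n. duality_map (g n)) \<longlongrightarrow> duality_map p) G"
proof (rule tendstoI)
  fix e :: real assume e: "0 < e"
  define \<eta> where "\<eta> = e / 2"
  have \<eta>: "0 < \<eta>" using e by (simp add: \<eta>_def)
  obtain \<delta> where \<delta>: "\<delta> > 0" "\<And>h. norm h < \<delta> \<Longrightarrow>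
      (norm (p + h))\<^sup>2 + (norm (p - h))\<^sup>2 \<le> 2 * (norm p)\<^sup>2 + \<eta> * norm h"
    using uniformly_smooth_near[OF smooth \<eta>, of p] by auto
  define t where "t = \<delta> / 2"
  have t: "0 < t" "t < \<delta>" using \<delta> by (auto simp: t_def)
  \<comment> \<open>The error of centring the first inequality at \<open>g n\<close> instead of
    \<open>p\<close>. It vanishes in the limit while the test radius \<open>t\<close> stays
    fixed.\<close>
  define r where "r n = (norm p)\<^sup>2 - (norm (g n))\<^sup>2 + 2 * (norm (g n) * norm (p - g n))" for n
  have "(r \<longlongrightarrow> (norm p)\<^sup>2 - (norm p)\<^sup>2 + 2 * (norm p * norm (p - p))) G"
    unfolding r_def by (intro tendsto_intros lim)
  then have "\<forall>\<^sub>F n in G. r n < \<eta> * t"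
    using \<eta> t by (intro order_tendstoD(2)[where y = "(norm p)\<^sup>2 - (norm p)\<^sup>2 + 2 * (norm p * norm (p - p))"]) auto
  then show "\<forall>\<^sub>F n in G. dist (duality_map (g n)) (duality_map p) < e"
  proof eventually_elim
    case (elim n)
    let ?D = "duality_map (g n) - duality_map p"
    have small: "blinfun_apply ?D h \<le> \<eta> * t" if h: "norm h = t" for h
    proof -
      have "(norm (p + h))\<^sup>2 \<ge> (norm (g n))\<^sup>2 + 2 * blinfun_apply (duality_map (g n)) (p - g n)
          + 2 * blinfun_apply (duality_map (g n)) h"
        using duality_map_subgradient[of "g n" "p + h"]
        by (simp add: blinfun.add_right blinfun.diff_right)
      moreover have "(norm (p - h))\<^sup>2 \<ge> (norm p)\<^sup>2 - 2 * blinfun_apply (duality_map p) h"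
        using duality_map_subgradient[of p "p - h"]
        by (simp add: blinfun.minus_right)
      moreover have "\<bar>blinfun_apply (duality_map (g n)) (p - g n)\<bar> \<le> norm (g n) * norm (p - g n)"
        using norm_blinfun[of "duality_map (g n)" "p - g n"] by (simp add: norm_duality_map)
      ultimately have "2 * blinfun_apply ?D h \<le> r n + \<eta> * t"
        using \<delta>(2)[of h] h t unfolding r_def by (simp add: blinfun.diff_left)
      then show ?thesis using elim by simp
    qed
    have bound: "blinfun_apply ?D h \<le> \<eta> * norm h" for h
    proof (cases "h = 0")
      case False
      have "blinfun_apply ?D ((t / norm h) *\<^sub>R h) \<le> \<eta> * t"
        using False t by (intro small) simp
      then show ?thesis
        using t False by (simp add: blinfun.scaleR_right field_simps)
    qed simp
    have "norm ?D \<le> \<eta>"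
    proof (rule norm_blinfun_bound)
      show "norm (blinfun_apply ?D h) \<le> \<eta> * norm h" for h
        using bound[of h] bound[of "- h"] by (simp add: blinfun.minus_right abs_le_iff)
    qed (use \<eta> in simp)
    then show ?case using e by (simp add: dist_norm \<eta>_def)
  qed
qed

text \<open>The Bregman distance of the squared norm: its gap at \<open>w\<close> above the tangent
  at \<open>v\<close>. Nonnegativity and the three-point identity are read off from this.\<close>

lemma lyapunov_eq:
  "lyapunov (w :: 'a) v = (norm w)\<^sup>2 - (norm v)\<^sup>2 - 2 * blinfun_apply (duality_map v) (w - v)"
  by (simp add: lyapunov_def blinfun.diff_right duality_map_self)

lemma lyapunov_nonneg: "0 \<le> lyapunov (w :: 'a) v"
  using duality_map_subgradient[of v w] by (simp add: lyapunov_eq)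

lemma lyapunov_three_point:
  "lyapunov (q :: 'a) v = lyapunov q w + lyapunov w v
     + 2 * blinfun_apply (duality_map w - duality_map v) (q - w)"
  by (simp add: lyapunov_def blinfun.diff_right blinfun.diff_left duality_map_self)

lemma lyapunov_le: "lyapunov (w :: 'a) v \<le> (norm w + norm v)\<^sup>2"
  using norm_blinfun[of "duality_map v" w]
  by (simp add: lyapunov_def norm_duality_map power2_sum mult.commute abs_le_iff)

lemma lyapunov_tendsto:
  assumes "(g \<longlongrightarrow> (p :: 'a)) G" "(h \<longlongrightarrow> q) G"
  shows "((\<lambda>n. lyapunov (g n) (h n)) \<longlongrightarrow> lyapunov p q) G"
  unfolding lyapunov_def
  by (intro tendsto_intros assms blinfun.tendsto duality_map_tendsto)

end

section \<open>Consequences of 2-uniform convexity\<close>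

lemma two_uniformly_convex_unit:
  assumes "two_uniformly_convex TYPE('a::real_normed_vector)"
  obtains \<kappa> where "\<kappa> > 0"
    "\<And>x y :: 'a. norm x = 1 \<Longrightarrow> norm y = 1 \<Longrightarrow> norm (x + y) \<le> 2 - 2 * \<kappa> * (norm (x - y))\<^sup>2"
proof -
  obtain \<kappa> where \<kappa>: "\<kappa> > 0" "\<And>\<epsilon>. 0 < \<epsilon> \<Longrightarrow> \<epsilon> \<le> 2 \<Longrightarrow> \<kappa> * \<epsilon>\<^sup>2 \<le> modulus_of_convexity TYPE('a) \<epsilon>"
    using assms unfolding two_uniformly_convex_def by auto
  have "norm (x + y) \<le> 2 - 2 * \<kappa> * (norm (x - y))\<^sup>2" if xy: "norm x = 1" "norm y = 1" for x y :: 'a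
  proof (cases "x = y")
    case True
    then show ?thesis using norm_triangle_ineq[of x y] xy by simp
  next
    case False
    let ?e = "norm (x - y)"
    let ?S = "{1 - norm ((1/2) *\<^sub>R (x + y)) | x y :: 'a. norm x = 1 \<and> norm y = 1 \<and> norm (x - y) \<ge> ?e}"
    have "bdd_below ?S"
    proof (rule bdd_belowI)
      fix s assume "s \<in> ?S"
      then obtain x y :: 'a where "s = 1 - norm ((1/2) *\<^sub>R (x + y))" "norm x = 1" "norm y = 1"
        by auto
      then show "0 \<le> s" using norm_triangle_ineq[of x y] by simp
    qed
    then have "modulus_of_convexity TYPE('a) ?e \<le> 1 - norm ((1/2) *\<^sub>R (x + y))"
      unfolding modulus_of_convexity_def using xy by (intro cInf_lower) auto
    moreover have "\<kappa> * ?e\<^sup>2 \<le> modulus_of_convexity TYPE('a) ?e"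
      using False norm_triangle_ineq4[of x y] xy by (intro \<kappa>(2)) auto
    ultimately have "\<kappa> * ?e\<^sup>2 \<le> 1 - norm ((1/2) *\<^sub>R (x + y))" by (rule order_trans[rotated])
    then show ?thesis by simp
  qed
  with \<kappa>(1) show ?thesis using that by blast
qed

text \<open>Writing \<open>y = t *\<^sub>R y'\<close> with \<open>y'\<close> on the sphere separates
  two sources of distance. The difference in length gains \<open>(1 - t)\<^sup>2 / 4\<close>, which
  gives the constant \<open>1 / 8\<close>; the difference in direction gains \<open>s / 2\<close>,
  which gives \<open>\<kappa> / 4\<close>.\<close>

lemma two_uniformly_convex_ball:
  assumes \<kappa>: "\<kappa> > 0"
    "\<And>x y :: 'a::real_normed_vector. norm x = 1 \<Longrightarrow> norm y = 1 \<Longrightarrow>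
       norm (x + y) \<le> 2 - 2 * \<kappa> * (norm (x - y))\<^sup>2"
    and xy: "norm x = 1" "norm (y :: 'a) \<le> 1"
  shows "min (1 / 8) (\<kappa> / 4) * (norm (x - y))\<^sup>2 + (norm ((1 / 2) *\<^sub>R (x + y)))\<^sup>2 \<le> (1 + (norm y)\<^sup>2) / 2"
proof (cases "y = 0")
  case True
  have "min (1 / 8) (\<kappa> / 4) \<le> 1 / 8" by simp
  then show ?thesis using True xy by (simp add: power_divide)
next
  case False
  define t where "t = norm y"
  define y' where "y' = (1 / t) *\<^sub>R y"
  define e where "e = norm (x - y')"
  define s where "s = t * \<kappa> * e\<^sup>2"
  have t: "0 < t" "t \<le> 1" using False xy by (auto simp: t_def)
  have y': "norm y' = 1" "y = t *\<^sub>R y'" using t by (auto simp: y'_def t_def)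
  have s: "0 \<le> s" using t \<kappa> by (simp add: s_def)
  have "x + y = t *\<^sub>R (x + y') + (1 - t) *\<^sub>R x" by (simp add: y'(2) algebra_simps)
  then have "norm (x + y) \<le> t * norm (x + y') + (1 - t)"
    using norm_triangle_ineq[of "t *\<^sub>R (x + y')" "(1 - t) *\<^sub>R x"] t xy by simp
  also have "t * norm (x + y') \<le> t * (2 - 2 * \<kappa> * e\<^sup>2)"
    using \<kappa>(2)[OF xy(1) y'(1)] t by (simp add: e_def)
  finally have m: "norm ((1 / 2) *\<^sub>R (x + y)) \<le> (1 + t) / 2 - s"
    by (simp add: s_def algebra_simps flip: scaleR_add_right)
  then have sm: "s \<le> (1 + t) / 2" using norm_ge_zero[of "(1 / 2) *\<^sub>R (x + y)"] by linarith
  have "(norm ((1 / 2) *\<^sub>R (x + y)))\<^sup>2 \<le> ((1 + t) / 2 - s)\<^sup>2"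
    by (rule power_mono[OF m norm_ge_zero])
  \<comment> \<open>Arranged so that the last two products are nonnegative: the bracket in the first
    bounds the norm of the midpoint from above.\<close>
  also have "\<dots> = (1 + t\<^sup>2) / 2 - (1 - t)\<^sup>2 / 4 - s / 2 - s * ((1 + t) / 2 - s) - s * t / 2"
    by (simp add: power2_eq_square field_simps)
  also have "\<dots> \<le> (1 + t\<^sup>2) / 2 - (1 - t)\<^sup>2 / 4 - s / 2"
    using mult_nonneg_nonneg[of s "(1 + t) / 2 - s"] mult_nonneg_nonneg[of s t] s sm t by linarith
  finally have main: "(norm ((1 / 2) *\<^sub>R (x + y)))\<^sup>2 \<le> (1 + t\<^sup>2) / 2 - (1 - t)\<^sup>2 / 4 - s / 2" .
  have "x - y = t *\<^sub>R (x - y') + (1 - t) *\<^sub>R x" by (simp add: y'(2) algebra_simps)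
  then have "norm (x - y) \<le> t * e + (1 - t)"
    using norm_triangle_ineq[of "t *\<^sub>R (x - y')" "(1 - t) *\<^sub>R x"] t xy by (simp add: e_def)
  then have "(norm (x - y))\<^sup>2 \<le> (t * e + (1 - t))\<^sup>2" by (simp add: power_mono)
  also have "\<dots> \<le> 2 * (t * e)\<^sup>2 + 2 * (1 - t)\<^sup>2"
    using zero_le_power2[of "t * e - (1 - t)"] by (simp add: power2_sum power2_diff)
  also have "(t * e)\<^sup>2 \<le> t * e\<^sup>2"
    unfolding power_mult_distrib using t
    by (intro mult_right_mono) (auto simp: power2_eq_square mult_left_le)
  finally have d: "(norm (x - y))\<^sup>2 \<le> 2 * (t * e\<^sup>2) + 2 * (1 - t)\<^sup>2" by simp
  have "min (1 / 8) (\<kappa> / 4) * (norm (x - y))\<^sup>2 \<le> min (1 / 8) (\<kappa> / 4) * (2 * (t * e\<^sup>2) + 2 * (1 - t)\<^sup>2)"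
    using d \<kappa>(1) by (intro mult_left_mono) auto
  also have "\<dots> = min (1 / 8) (\<kappa> / 4) * (2 * (t * e\<^sup>2)) + min (1 / 8) (\<kappa> / 4) * (2 * (1 - t)\<^sup>2)"
    by (rule distrib_left)
  also have "\<dots> \<le> \<kappa> / 4 * (2 * (t * e\<^sup>2)) + 1 / 8 * (2 * (1 - t)\<^sup>2)"
    using t by (intro add_mono mult_right_mono) auto
  also have "\<dots> = s / 2 + (1 - t)\<^sup>2 / 4" by (simp add: s_def)
  finally show ?thesis using main unfolding t_def by argo
qed

text \<open>A weak parallelogram law. Both sides are symmetric and homogeneous of degree two, so
  dividing by the larger norm reduces it to one point on the sphere and one in the ball.\<close>

lemma two_uniformly_convex_midpoint:
  assumes "two_uniformly_convex TYPE('a::real_normed_vector)"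
  obtains \<mu> where "\<mu> > 0"
    "\<And>x y :: 'a. \<mu> * (norm (x - y))\<^sup>2 + (norm ((1 / 2) *\<^sub>R (x + y)))\<^sup>2 \<le> ((norm x)\<^sup>2 + (norm y)\<^sup>2) / 2"
proof -
  obtain \<kappa> where \<kappa>: "\<kappa> > 0" "\<And>x y :: 'a. norm x = 1 \<Longrightarrow> norm y = 1 \<Longrightarrow>
       norm (x + y) \<le> 2 - 2 * \<kappa> * (norm (x - y))\<^sup>2"
    using two_uniformly_convex_unit[OF assms] by blast
  define \<mu> where "\<mu> = min (1 / 8) (\<kappa> / 4)"
  have *: "\<mu> * (norm (x - y))\<^sup>2 + (norm ((1 / 2) *\<^sub>R (x + y)))\<^sup>2 \<le> ((norm x)\<^sup>2 + (norm y)\<^sup>2) / 2"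
    if "norm y \<le> norm x" for x y :: 'a
  proof (cases "x = 0")
    case False
    define r where "r = norm x"
    have r: "0 < r" using False by (simp add: r_def)
    have "\<mu> * (norm ((1/r) *\<^sub>R x - (1/r) *\<^sub>R y))\<^sup>2 + (norm ((1 / 2) *\<^sub>R ((1/r) *\<^sub>R x + (1/r) *\<^sub>R y)))\<^sup>2
        \<le> (1 + (norm ((1/r) *\<^sub>R y))\<^sup>2) / 2"
      unfolding \<mu>_def using that r by (intro two_uniformly_convex_ball[OF \<kappa>]) (auto simp: r_def)
    also have "(1/r) *\<^sub>R x - (1/r) *\<^sub>R y = (1/r) *\<^sub>R (x - y)" by (simp add: algebra_simps)
    also have "(1 / 2) *\<^sub>R ((1/r) *\<^sub>R x + (1/r) *\<^sub>R y) = (1/r) *\<^sub>R ((1 / 2) *\<^sub>R (x + y))"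
      by (simp add: algebra_simps)
    finally have "\<mu> * ((1/r)\<^sup>2 * (norm (x - y))\<^sup>2) + (1/r)\<^sup>2 * (norm ((1 / 2) *\<^sub>R (x + y)))\<^sup>2
        \<le> (1 + (1/r)\<^sup>2 * (norm y)\<^sup>2) / 2"
      using r by (simp only: norm_scaleR power_mult_distrib power2_abs)
    then have "(\<mu> * ((1/r)\<^sup>2 * (norm (x - y))\<^sup>2) + (1/r)\<^sup>2 * (norm ((1 / 2) *\<^sub>R (x + y)))\<^sup>2) * r\<^sup>2
        \<le> ((1 + (1/r)\<^sup>2 * (norm y)\<^sup>2) / 2) * r\<^sup>2"
      by (intro mult_right_mono) auto
    moreover have "(1/r)\<^sup>2 * q * r\<^sup>2 = q" for q
      using r by (simp add: power_divide)
    ultimately show ?thesis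
      using r by (simp add: r_def[symmetric] distrib_right mult.assoc add_divide_distrib power_divide)
  qed (use that in auto)
  have "\<mu> * (norm (x - y))\<^sup>2 + (norm ((1 / 2) *\<^sub>R (x + y)))\<^sup>2 \<le> ((norm x)\<^sup>2 + (norm y)\<^sup>2) / 2" for x y :: 'a
    using *[of x y] *[of y x] by (cases "norm y \<le> norm x") (simp_all add: norm_minus_commute add.commute)
  moreover have "\<mu> > 0" using \<kappa> by (simp add: \<mu>_def)
  ultimately show ?thesis using that by blast
qed

text \<open>Existence of minimizers and the finite intersection property use only this inequality
  and completeness; smoothness is added later. The argument \<open>E\<close> serves to fix the
  type.\<close>

locale midpoint_convex =
  fixes \<mu> :: real and E :: "'a::banach itself"
  assumes \<mu>_pos: "\<mu> > 0"
    and midpoint: "\<And>x y :: 'a. \<mu> * (norm (x - y))\<^sup>2 + (norm ((1 / 2) *\<^sub>R (x + y)))\<^sup>2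
                     \<le> ((norm x)\<^sup>2 + (norm y)\<^sup>2) / 2"
begin

text \<open>The term \<open>g\<close> is linear, so the gain from \<open>midpoint\<close> survives;
  the midpoint of \<open>v\<close> and \<open>w\<close> lies in \<open>D\<close> and cannot fall
  below \<open>m\<close>.\<close>

lemma near_minimizers_close:
  fixes g :: "'a \<Rightarrow>\<^sub>L real"
  assumes D: "convex D" "v \<in> D" "w \<in> D"
    and low: "\<And>z. z \<in> D \<Longrightarrow> m \<le> (norm z)\<^sup>2 - 2 * g z"
  shows "\<mu> * (norm (v - w))\<^sup>2 \<le> (((norm v)\<^sup>2 - 2 * g v) + ((norm w)\<^sup>2 - 2 * g w)) / 2 - m"
proof -
  have "(1 / 2) *\<^sub>R (v + w) \<in> D"
    using convexD[OF D, of "1/2" "1/2"] by (simp add: algebra_simps)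
  from low[OF this] show ?thesis
    using midpoint[of v w]
    by (simp only: blinfun.add_right blinfun.scaleR_right real_scaleR_def) argo
qed

text \<open>Serves three times: with \<open>g = 0\<close> for points of minimal norm, with
  \<open>g\<close> a value of the duality mapping for generalized projections, and with
  \<open>D = UNIV\<close> for surjectivity of the duality mapping.\<close>

lemma minimizer_exists:
  fixes g :: "'a \<Rightarrow>\<^sub>L real"
  assumes D: "closed D" "convex D" "D \<noteq> {}"
  shows "\<exists>v\<in>D. \<forall>w\<in>D. (norm v)\<^sup>2 - 2 * g v \<le> (norm w)\<^sup>2 - 2 * g w"
proof -
  let ?h = "\<lambda>w. (norm w)\<^sup>2 - 2 * g w"
  define m where "m = (INF w\<in>D. ?h w)"
  have "- (norm g)\<^sup>2 \<le> ?h w" for w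
  proof -
    have "g w \<le> norm g * norm w" using norm_blinfun[of g w] by simp
    then show ?thesis
      using zero_le_power2[of "norm w - norm g"] by (simp add: power2_diff algebra_simps)
  qed
  then have bdd: "bdd_below (?h ` D)" by (intro bdd_belowI[where m = "- (norm g)\<^sup>2"]) auto
  then have m_le: "m \<le> ?h w" if "w \<in> D" for w
    unfolding m_def using that by (intro cINF_lower)
  have "\<exists>w\<in>D. ?h w < m + 1 / real (Suc n)" for n
    using cINF_less_iff[OF D(3) bdd, of "m + 1 / real (Suc n)"] by (simp add: m_def)
  then obtain v where v: "\<And>n. v n \<in> D" "\<And>n. ?h (v n) < m + 1 / real (Suc n)" by metis
  have close: "\<mu> * (norm (v i - v j))\<^sup>2 \<le> 1 / real (Suc n)" if "n \<le> i" "n \<le> j" for i j n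
  proof -
    have "1 / real (Suc i) \<le> 1 / real (Suc n)" "1 / real (Suc j) \<le> 1 / real (Suc n)"
      using that by (auto simp: frac_le)
    moreover have "\<mu> * (norm (v i - v j))\<^sup>2 \<le> (?h (v i) + ?h (v j)) / 2 - m"
      using near_minimizers_close[OF D(2) v(1)[of i] v(1)[of j]] m_le by blast
    ultimately show ?thesis using v(2)[of i] v(2)[of j] by argo
  qed
  have "Cauchy v"
  proof (rule metric_CauchyI)
    fix e :: real assume e: "0 < e"
    obtain n where n: "1 / real (Suc n) < \<mu> * e\<^sup>2"
      using nat_approx_posE[of "\<mu> * e\<^sup>2"] e \<mu>_pos by auto
    have "dist (v i) (v j) < e" if "n \<le> i" "n \<le> j" for i j
    proof -
      have "(norm (v i - v j))\<^sup>2 < e\<^sup>2"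
        using close[OF that] n \<mu>_pos by (meson le_less_trans mult_less_cancel_left_pos)
      then show ?thesis using e by (simp add: dist_norm power_less_imp_less_base)
    qed
    then show "\<exists>M. \<forall>i\<ge>M. \<forall>j\<ge>M. dist (v i) (v j) < e" by blast
  qed
  then obtain p where p: "v \<longlonglongrightarrow> p" by (auto dest: Cauchy_convergent convergentD)
  have "p \<in> D" using closed_sequentially[OF D(1)] v(1) p by blast
  have "(\<lambda>n. ?h (v n)) \<longlonglongrightarrow> ?h p"
    by (intro tendsto_intros p blinfun.tendsto)
  moreover have "(\<lambda>n. m + 1 / real (Suc n)) \<longlonglongrightarrow> m + 0"
    by (intro tendsto_add tendsto_const LIMSEQ_Suc lim_1_over_n)
  ultimately have "?h p \<le> m + 0"
    using v(2) by (intro LIMSEQ_le) (auto intro: less_imp_le)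
  with m_le \<open>p \<in> D\<close> show ?thesis by force
qed

text \<open>This replaces the weak compactness of bounded closed convex sets: the points of minimal norm in
  finite intersections form a Cauchy sequence along a sequence of index sets that nearly maximizes
  the minimal norm.\<close>

lemma closed_convex_fip:
  fixes Ks :: "'i \<Rightarrow> 'a set"
  assumes cl: "\<And>i. i \<in> I \<Longrightarrow> closed (Ks i)" and cv: "\<And>i. i \<in> I \<Longrightarrow> convex (Ks i)"
    and ne: "\<And>J. finite J \<Longrightarrow> J \<subseteq> I \<Longrightarrow> (\<Inter>i\<in>J. Ks i) \<noteq> {}"
    and i0: "i0 \<in> I" "bounded (Ks i0)"
  shows "(\<Inter>i\<in>I. Ks i) \<noteq> {}"
proof -
  \<comment> \<open>Every index set contains \<open>i0\<close>, so boundedness of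
    \<open>Ks i0\<close> bounds the minimal norms.\<close>
  define Js where "Js = {J. finite J \<and> J \<subseteq> I \<and> i0 \<in> J}"
  define KK where "KK J = (\<Inter>i\<in>J. Ks i)" for J
  have KK: "closed (KK J)" "convex (KK J)" "KK J \<noteq> {}" "KK J \<subseteq> Ks i0" if "J \<in> Js" for J
    using that cl cv ne unfolding KK_def Js_def by (auto intro!: closed_INT convex_INT)
  have "\<exists>v\<in>KK J. \<forall>w\<in>KK J. (norm v)\<^sup>2 \<le> (norm w)\<^sup>2" if "J \<in> Js" for J
    using minimizer_exists[OF KK(1-3)[OF that], of 0] by simp
  then obtain v where v: "\<And>J. J \<in> Js \<Longrightarrow> v J \<in> KK J"
      "\<And>J w. J \<in> Js \<Longrightarrow> w \<in> KK J \<Longrightarrow> (norm (v J))\<^sup>2 \<le> (norm w)\<^sup>2" by metis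
  define m where "m J = (norm (v J))\<^sup>2" for J
  have antimono: "KK J' \<subseteq> KK J" if "J \<subseteq> J'" for J J' using that unfolding KK_def by auto
  have mono: "m J \<le> m J'" if "J \<in> Js" "J' \<in> Js" "J \<subseteq> J'" for J J'
    unfolding m_def using v antimono that by (meson subsetD)
  have close: "\<mu> * (norm (v J - v J'))\<^sup>2 \<le> (m J' - m J) / 2" if J: "J \<in> Js" "J' \<in> Js" "J \<subseteq> J'" for J J'
    using near_minimizers_close[OF KK(2)[OF J(1)] v(1)[OF J(1)], of "v J'" "m J" 0]
      v(1)[OF J(2)] antimono[OF J(3)] v(2)[OF J(1)] unfolding m_def by auto
  obtain R where R: "\<And>w. w \<in> Ks i0 \<Longrightarrow> norm w \<le> R" using i0(2) unfolding bounded_iff by auto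
  have bdd: "bdd_above (m ` Js)"
  proof (rule bdd_aboveI2)
    fix J assume "J \<in> Js"
    then show "m J \<le> R\<^sup>2" unfolding m_def using v(1) KK(4) R by (intro power_mono) auto
  qed
  have Js_ne: "Js \<noteq> {}" using i0 unfolding Js_def by (auto intro!: exI[of _ "{i0}"])
  define d where "d = (SUP J\<in>Js. m J)"
  have m_le: "m J \<le> d" if "J \<in> Js" for J unfolding d_def by (rule cSUP_upper[OF that bdd])
  have "\<exists>J\<in>Js. d - 1 / real (Suc n) < m J" for n
    using less_cSUP_iff[OF Js_ne bdd, of "d - 1 / real (Suc n)"] by (simp add: d_def)
  then obtain Jn where Jn: "\<And>n. Jn n \<in> Js" "\<And>n. d - 1 / real (Suc n) < m (Jn n)" by metis
  \<comment> \<open>The estimate \<open>close\<close> compares nested index sets only, hence the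
    unions.\<close>
  define Z where "Z n = (\<Union>k\<le>n. Jn k)" for n
  have Z: "Z n \<in> Js" "Jn n \<subseteq> Z n" for n using Jn(1) unfolding Z_def Js_def by auto
  have Z_mono: "Z i \<subseteq> Z j" if "i \<le> j" for i j using that unfolding Z_def by force
  have mZ: "d - 1 / real (Suc n) < m (Z n)" for n
    using Jn(2)[of n] mono[OF Jn(1) Z(1) Z(2), of n] by linarith
  have close_Z: "\<mu> * (norm (v (Z n) - v J))\<^sup>2 \<le> 1 / real (Suc n)" if "J \<in> Js" "Z n \<subseteq> J" for n J
  proof -
    have "0 \<le> 1 / real (Suc n)" by simp
    then show ?thesis using close[OF Z(1) that] mZ[of n] m_le[OF that(1)] by argo
  qed
  have "Cauchy (\<lambda>n. v (Z n))"
  proof (rule metric_CauchyI)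
    fix e :: real assume e: "0 < e"
    obtain n where n: "1 / real (Suc n) < \<mu> * (e / 2)\<^sup>2"
      using nat_approx_posE[of "\<mu> * (e / 2)\<^sup>2"] e \<mu>_pos by auto
    have *: "dist (v (Z n)) (v (Z i)) < e / 2" if "n \<le> i" for i
    proof -
      have "(norm (v (Z n) - v (Z i)))\<^sup>2 < (e / 2)\<^sup>2"
        using close_Z[OF Z(1) Z_mono[OF that]] n \<mu>_pos by (meson le_less_trans mult_less_cancel_left_pos)
      then show ?thesis using e by (metis dist_norm half_gt_zero less_imp_le power_less_imp_less_base)
    qed
    have "dist (v (Z i)) (v (Z j)) < e" if "n \<le> i" "n \<le> j" for i j
      using *[OF that(1)] *[OF that(2)] dist_triangle_half_r by blast
    then show "\<exists>M. \<forall>i\<ge>M. \<forall>j\<ge>M. dist (v (Z i)) (v (Z j)) < e" by blast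
  qed
  then obtain p where p: "(\<lambda>n. v (Z n)) \<longlonglongrightarrow> p" by (auto dest: Cauchy_convergent convergentD)
  have "p \<in> Ks i" if i: "i \<in> I" for i
  proof -
    \<comment> \<open>Adding \<open>i\<close> to \<open>Z n\<close> moves the minimal norm point by
      an amount that tends to \<open>0\<close> and places it in \<open>Ks i\<close>, so the limit
      lies there too.\<close>
    define w where "w n = v (insert i (Z n))" for n
    have ins: "insert i (Z n) \<in> Js" for n using Z(1)[of n] i unfolding Js_def by auto
    have w_mem: "w n \<in> Ks i" for n using v(1)[OF ins[of n]] unfolding w_def KK_def by auto
    have "(\<lambda>n. (norm (v (Z n) - w n))\<^sup>2) \<longlonglongrightarrow> 0"
    proof (rule tendsto_sandwich[of "\<lambda>_. 0" _ _ "\<lambda>n. (1 / \<mu>) * (1 / real (Suc n))"])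
      have "(norm (v (Z n) - w n))\<^sup>2 \<le> 1 / \<mu> * (1 / real (Suc n))" for n
        using mult_left_mono[OF close_Z[OF ins[of n] subset_insertI], of "1 / \<mu>"] \<mu>_pos
        unfolding w_def by simp
      then show "\<forall>\<^sub>F n in sequentially. (norm (v (Z n) - w n))\<^sup>2 \<le> 1 / \<mu> * (1 / real (Suc n))" by simp
      show "(\<lambda>n. (1 / \<mu>) * (1 / real (Suc n))) \<longlonglongrightarrow> 0"
        by (intro tendsto_mult_right_zero LIMSEQ_Suc lim_1_over_n)
    qed auto
    then have "(\<lambda>n. v (Z n) - w n) \<longlonglongrightarrow> 0" by (simp add: tendsto_norm_zero_iff)
    from tendsto_diff[OF p this] have "w \<longlonglongrightarrow> p" by simp
    then show ?thesis using closed_sequentially[OF cl[OF i]] w_mem by blast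
  qed
  then show ?thesis by blast
qed

end

text \<open>\<open>arg_min_on\<close> chooses among the minimizers, so identifying its value needs
  uniqueness as well. For \<open>F\<close>, uniqueness will come from the iterates.\<close>

lemma gen_proj_eqI:
  assumes "p \<in> D" "\<And>q. q \<in> D \<Longrightarrow> lyapunov p v \<le> lyapunov q v"
    and "\<And>q. q \<in> D \<Longrightarrow> (\<And>w. w \<in> D \<Longrightarrow> lyapunov q v \<le> lyapunov w v) \<Longrightarrow> q = p"
  shows "gen_proj D v = p"
  unfolding gen_proj_def arg_min_on_def arg_min_def
proof (rule some_equality)
  show "is_arg_min (\<lambda>y. lyapunov y v) (\<lambda>x. x \<in> D) p"
    using assms(1,2) by (auto simp: is_arg_min_linorder)
  show "q = p" if "is_arg_min (\<lambda>y. lyapunov y v) (\<lambda>x. x \<in> D) q" for q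
    using assms(3) that by (auto simp: is_arg_min_linorder)
qed

section \<open>Bijectivity of the duality mapping, generalized projections and the constant
  \<open>c\<close>\<close>

locale smooth_convex = midpoint_convex \<mu> E for \<mu> and E :: "'a::banach itself" +
  assumes smooth: "uniformly_smooth TYPE('a)"
begin

lemmas J_norm = norm_duality_map[OF smooth]
  and J_subgradient = duality_map_subgradient[OF smooth]
  and J_tendsto = duality_map_tendsto[OF smooth]
  and three_point = lyapunov_three_point[OF smooth]

text \<open>The tangent inequality at \<open>w\<close> is applied at the midpoint instead of at
  \<open>v\<close>; the midpoint gain then remains as the quadratic term.\<close>

lemma lyapunov_lower: "2 * \<mu> * (norm (v - w))\<^sup>2 \<le> lyapunov v (w :: 'a)"
proof -
  have "(norm ((1 / 2) *\<^sub>R (v + w)))\<^sup>2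
      \<ge> (norm w)\<^sup>2 + 2 * duality_map w ((1 / 2) *\<^sub>R (v + w) - w)"
    by (rule J_subgradient)
  also have "(1 / 2) *\<^sub>R (v + w) - w = (1 / 2) *\<^sub>R (v - w)"
    by (simp add: algebra_simps flip: scaleR_add_left)
  finally have "(norm w)\<^sup>2 + duality_map w (v - w) \<le> (norm ((1 / 2) *\<^sub>R (v + w)))\<^sup>2"
    by (simp add: blinfun.scaleR_right)
  then show ?thesis
    using midpoint[of v w] unfolding lyapunov_eq[OF smooth] by argo
qed

lemma J_strongly_monotone:
  "2 * \<mu> * (norm (v - w))\<^sup>2 \<le> (duality_map v - duality_map (w :: 'a)) (v - w)"
  using lyapunov_lower[of v w] lyapunov_lower[of w v]
  by (simp add: lyapunov_eq[OF smooth] norm_minus_commute blinfun.diff_left blinfun.diff_right)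

text \<open>Lipschitz continuity of the inverse duality mapping, stated before that inverse is
  available; it yields injectivity and an admissible constant for \<open>two_uc_c\<close>.\<close>

lemma J_expanding: "2 * \<mu> * norm (v - w) \<le> norm (duality_map v - duality_map (w :: 'a))"
proof (cases "v = w")
  case False
  have "2 * \<mu> * (norm (v - w))\<^sup>2 \<le> norm (duality_map v - duality_map w) * norm (v - w)"
    using J_strongly_monotone[of v w] norm_blinfun[of "duality_map v - duality_map w" "v - w"] by simp
  then show ?thesis using False by (simp add: power2_eq_square mult.assoc[symmetric])
qed simp

lemma minimizer_variational:
  assumes D: "convex D" "v \<in> D" "w \<in> D"
    and min: "\<And>w. w \<in> D \<Longrightarrow> (norm v)\<^sup>2 - 2 * blinfun_apply g v \<le> (norm w)\<^sup>2 - 2 * blinfun_apply g w"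
  shows "(g - duality_map (v :: 'a)) (w - v) \<le> 0"
proof -
  have small: "g (w - v) \<le> sq_quot v (w - v) t" if t: "0 < t" "t \<le> 1" for t
  proof -
    have "(1 - t) *\<^sub>R v + t *\<^sub>R w \<in> D" using convexD_alt[OF D, of t] t by simp
    also have "(1 - t) *\<^sub>R v + t *\<^sub>R w = v + t *\<^sub>R (w - v)" by (simp add: algebra_simps)
    finally have "g (w - v) * (2 * t) \<le> (norm (v + t *\<^sub>R (w - v)))\<^sup>2 - (norm v)\<^sup>2"
      using min[of "v + t *\<^sub>R (w - v)"]
      by (simp add: blinfun.add_right blinfun.diff_right blinfun.scaleR_right algebra_simps)
    then show ?thesis unfolding sq_quot_def using t by (simp add: pos_le_divide_eq)
  qed
  have "g (w - v) \<le> sq_deriv v (w - v)"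
  \<comment> \<open>The segment stays in \<open>D\<close> only for steps up to \<open>1\<close>,
    whereas the infimum runs over all positive steps; monotonicity of the quotient bridges
    this.\<close>
  proof (rule sq_deriv_ge)
    fix t :: real assume "0 < t"
    then show "g (w - v) \<le> sq_quot v (w - v) t"
      using small[of "min t 1"] sq_quot_mono[of "min t 1" t v "w - v"] by simp
  qed
  then show ?thesis by (simp add: blinfun.diff_left duality_map_eq_sq_deriv[OF smooth])
qed

text \<open>For surjectivity, \<open>(norm v)\<^sup>2 - 2 * g v\<close> is minimized over the whole
  space: the first-order condition at the minimizer is \<open>duality_map v = g\<close>.\<close>

lemma bij_J: "bij (duality_map :: 'a \<Rightarrow> _)"
proof (rule bijI)
  show "inj (duality_map :: 'a \<Rightarrow> _)"
  proof (rule injI)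
    fix v w :: 'a assume "duality_map v = duality_map w"
    then show "v = w" using J_expanding[of v w] \<mu>_pos by (simp add: mult_le_0_iff)
  qed
  show "surj (duality_map :: 'a \<Rightarrow> _)"
  proof (rule surjI)
    fix g :: "'a \<Rightarrow>\<^sub>L real"
    obtain v where v: "\<And>w. (norm v)\<^sup>2 - 2 * g v \<le> (norm w)\<^sup>2 - 2 * g w"
      using minimizer_exists[of UNIV g] by auto
    have "(g - duality_map v) h \<le> 0" for h
      using minimizer_variational[of UNIV v "v + h" g] v by simp
    from this[of "- h" for h] this have "duality_map v = g"
      by (intro blinfun_eqI) (simp add: blinfun.diff_left blinfun.minus_right antisym)
    then have "\<exists>v. duality_map v = g" by blast
    then show "duality_map (SOME v. duality_map v = g) = g" by (rule someI_ex)
  qed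
qed

lemma J_J_inv [simp]: "duality_map (duality_map_inv g :: 'a) = g"
  by (rule surj_f_inv_f) (rule bij_is_surj[OF bij_J])

lemma tendsto_of_J:
  assumes "((\<lambda>n. duality_map (v n)) \<longlongrightarrow> duality_map (p :: 'a)) G"
  shows "(v \<longlongrightarrow> p) G"
proof -
  have "((\<lambda>n. norm (v n - p)) \<longlongrightarrow> 0) G"
  proof (rule tendsto_sandwich[of "\<lambda>_. 0" _ _ "\<lambda>n. norm (duality_map (v n) - duality_map p) / (2 * \<mu>)"])
    have "norm (v n - p) \<le> norm (duality_map (v n) - duality_map p) / (2 * \<mu>)" for n
      using J_expanding[of "v n" p] \<mu>_pos by (simp add: field_simps)
    then show "\<forall>\<^sub>F n in G. norm (v n - p) \<le> norm (duality_map (v n) - duality_map p) / (2 * \<mu>)"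
      by simp
    have "((\<lambda>n. norm (duality_map (v n) - duality_map p) / (2 * \<mu>))
        \<longlongrightarrow> norm (duality_map p - duality_map p) / (2 * \<mu>)) G"
      using \<mu>_pos by (intro tendsto_intros assms) auto
    then show "((\<lambda>n. norm (duality_map (v n) - duality_map p) / (2 * \<mu>)) \<longlongrightarrow> 0) G" by simp
  qed auto
  then show ?thesis by (metis LIM_zero_cancel tendsto_norm_zero_iff)
qed

lemma diff_tendsto_0_of_lyapunov:
  assumes "((\<lambda>n. lyapunov (v n) (w n :: 'a)) \<longlongrightarrow> 0) G"
  shows "((\<lambda>n. v n - w n) \<longlongrightarrow> 0) G"
proof -
  have "((\<lambda>n. (norm (v n - w n))\<^sup>2) \<longlongrightarrow> 0) G"
  proof (rule tendsto_sandwich[of "\<lambda>_. 0" _ _ "\<lambda>n. lyapunov (v n) (w n) / (2 * \<mu>)"])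
    have "(norm (v n - w n))\<^sup>2 \<le> lyapunov (v n) (w n) / (2 * \<mu>)" for n
      using lyapunov_lower[of "v n" "w n"] \<mu>_pos by (simp add: field_simps)
    then show "\<forall>\<^sub>F n in G. (norm (v n - w n))\<^sup>2 \<le> lyapunov (v n) (w n) / (2 * \<mu>)" by simp
    show "((\<lambda>n. lyapunov (v n) (w n) / (2 * \<mu>)) \<longlongrightarrow> 0) G"
      using tendsto_divide[OF assms tendsto_const[of "2 * \<mu>"]] \<mu>_pos by simp
  qed auto
  then show ?thesis by (simp add: tendsto_norm_zero_iff)
qed

text \<open>As a function of its first argument, \<open>lyapunov\<close> differs from the functional
  of \<open>minimizer_exists\<close> by a constant, so existence and the first-order condition carry
  over.\<close>

lemma
  assumes D: "closed D" "convex D" "D \<noteq> {}"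
  shows gen_proj_in: "gen_proj D v \<in> D"
    and gen_proj_variational:
      "w \<in> D \<Longrightarrow> (duality_map v - duality_map (gen_proj D v)) (w - gen_proj D (v :: 'a)) \<le> 0"
proof -
  have "\<exists>p. is_arg_min (\<lambda>y. lyapunov y v) (\<lambda>x. x \<in> D) p"
    using minimizer_exists[OF D, of "duality_map v"] by (auto simp: is_arg_min_linorder lyapunov_def)
  then have "is_arg_min (\<lambda>y. lyapunov y v) (\<lambda>x. x \<in> D) (gen_proj D v)"
    unfolding gen_proj_def arg_min_on_def arg_min_def by (rule someI_ex)
  then have p: "gen_proj D v \<in> D" "\<And>w. w \<in> D \<Longrightarrow> lyapunov (gen_proj D v) v \<le> lyapunov w v"
    by (auto simp: is_arg_min_linorder)
  then show "gen_proj D v \<in> D" by simp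
  show "(duality_map v - duality_map (gen_proj D v)) (w - gen_proj D v) \<le> 0" if "w \<in> D"
    using p by (intro minimizer_variational[OF D(2) _ that]) (auto simp: lyapunov_def)
qed

lemma lyapunov_gen_proj:
  assumes "closed D" "convex D" "w \<in> D"
  shows "lyapunov w (gen_proj D v) + lyapunov (gen_proj D v) v \<le> lyapunov w (v :: 'a)"
  using three_point[of w v "gen_proj D v"] gen_proj_variational[OF assms(1,2) _ assms(3), of v] assms(3)
  by (auto simp: blinfun.diff_left)

lemma gen_proj_self:
  assumes "closed D" "convex D" "v \<in> D"
  shows "gen_proj D v = (v :: 'a)"
proof -
  have "lyapunov (gen_proj D v) v \<le> 0"
    using lyapunov_gen_proj[OF assms, of v] lyapunov_nonneg[OF smooth, of v "gen_proj D v"]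
    by (simp add: lyapunov_eq[OF smooth, of v v])
  then have "2 * \<mu> * (norm (gen_proj D v - v))\<^sup>2 \<le> 0"
    using lyapunov_lower order_trans by blast
  then show ?thesis using \<mu>_pos by (simp add: mult_le_0_iff)
qed

text \<open>\<open>GREATEST\<close> says something only if the maximum is attained. A violated
  inequality at the supremum \<open>s\<close> is strict and depends continuously on the constant, so
  it would persist at admissible constants just below \<open>s\<close>.\<close>

lemma
  shows two_uc_c_pos: "0 < two_uc_c TYPE('a)"
    and two_uc_c_le: "norm (v - w) \<le> 2 / (two_uc_c TYPE('a))\<^sup>2 * norm (duality_map v - duality_map (w :: 'a))"
proof -
  let ?P = "\<lambda>c::real. 0 < c \<and> c \<le> 1 \<and>
     (\<forall>x y :: 'a. norm (x - y) \<le> 2 / c\<^sup>2 * norm (duality_map x - duality_map y))"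
  let ?S = "{c. ?P c}"
  have "\<exists>c. ?P c"
  proof (intro exI conjI allI)
    \<comment> \<open>Makes \<open>2 / c\<^sup>2\<close> at least the Lipschitz constant
      \<open>1 / (2 * \<mu>)\<close> obtained from \<open>J_expanding\<close>.\<close>
    define c where "c = min 1 (sqrt (4 * \<mu>))"
    show c: "0 < c" "c \<le> 1" using \<mu>_pos by (auto simp: c_def)
    fix x y :: 'a
    have "c\<^sup>2 \<le> (sqrt (4 * \<mu>))\<^sup>2" using c by (intro power_mono) (auto simp: c_def)
    then have "c\<^sup>2 * norm (x - y) \<le> 4 * \<mu> * norm (x - y)"
      using \<mu>_pos by (intro mult_right_mono) auto
    also have "\<dots> \<le> 2 * norm (duality_map x - duality_map y)" using J_expanding[of x y] by simp
    finally show "norm (x - y) \<le> 2 / c\<^sup>2 * norm (duality_map x - duality_map y)"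
      using c by (simp add: field_simps)
  qed
  then obtain c1 where c1: "?P c1" by blast
  define s where "s = Sup ?S"
  have bdd: "bdd_above ?S" by (intro bdd_aboveI[of _ 1]) auto
  have s: "c \<le> s" if "?P c" for c unfolding s_def using that bdd by (intro cSup_upper) auto
  have sP: "?P s"
  proof (intro conjI allI)
    show s0: "0 < s" using s[OF c1] c1 by linarith
    show "s \<le> 1" unfolding s_def using c1 by (intro cSup_least) auto
    fix x y :: 'a
    show "norm (x - y) \<le> 2 / s\<^sup>2 * norm (duality_map x - duality_map y)"
    proof (rule ccontr)
      assume not: "\<not> ?thesis"
      have "((\<lambda>c. c\<^sup>2 * norm (x - y)) \<longlongrightarrow> s\<^sup>2 * norm (x - y)) (at_left s)"
        by (intro tendsto_intros)
      moreover have "2 * norm (duality_map x - duality_map y) < s\<^sup>2 * norm (x - y)"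
        using not s0 by (simp add: field_simps)
      ultimately have "\<forall>\<^sub>F c in at_left s. 2 * norm (duality_map x - duality_map y) < c\<^sup>2 * norm (x - y)"
        by (rule order_tendstoD(1))
      then obtain b where b: "b < s"
        "\<And>c. b < c \<Longrightarrow> c < s \<Longrightarrow> 2 * norm (duality_map x - duality_map y) < c\<^sup>2 * norm (x - y)"
        unfolding eventually_at_left_field by auto
      obtain c where c: "?P c" "b < c"
        using b(1) less_cSup_iff[of ?S b] bdd c1 unfolding s_def by auto
      have "c\<^sup>2 * norm (x - y) \<le> 2 * norm (duality_map x - duality_map y)"
        using c(1) by (auto simp: field_simps)
      moreover have "2 * norm (duality_map x - duality_map y) < c\<^sup>2 * norm (x - y)"
        using s[OF c(1)] b(2)[OF c(2)] not c(1) by (cases "c = s") auto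
      ultimately show False by simp
    qed
  qed
  have "two_uc_c TYPE('a) = s"
    unfolding two_uc_c_def using sP s by (intro Greatest_equality) auto
  then show "0 < two_uc_c TYPE('a)"
    "norm (v - w) \<le> 2 / (two_uc_c TYPE('a))\<^sup>2 * norm (duality_map v - duality_map w)"
    using sP by auto
qed

end

section \<open>Resolvents of equilibrium problems\<close>

lemma lsc_on_iff:
  "lsc_on C g \<longleftrightarrow> (\<forall>y\<in>C. \<forall>s<g y. \<forall>\<^sub>F x in at y within C. s < g x)"
proof
  assume lsc: "lsc_on C g"
  show "\<forall>y\<in>C. \<forall>s<g y. \<forall>\<^sub>F x in at y within C. s < g x"
  proof (intro ballI allI impI)
    fix y s assume "y \<in> C" "s < g y"
    then have "\<forall>\<^sub>F x in at y within C. ereal s < ereal (g x)"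
      using lsc unfolding lsc_on_def le_Liminf_iff by (metis ereal_less_eq(3) not_le)
    then show "\<forall>\<^sub>F x in at y within C. s < g x" by simp
  qed
next
  assume ev: "\<forall>y\<in>C. \<forall>s<g y. \<forall>\<^sub>F x in at y within C. s < g x"
  show "lsc_on C g"
    unfolding lsc_on_def le_Liminf_iff
  proof (intro ballI allI impI)
    fix y and s :: ereal assume "y \<in> C" "s < ereal (g y)"
    then show "\<forall>\<^sub>F x in at y within C. s < ereal (g x)"
      using ev by (cases s) auto
  qed
qed

lemma lsc_on_less:
  fixes C :: "'a::metric_space set"
  assumes "lsc_on C g" "y \<in> C" "s < g y"
  obtains \<delta> where "\<delta> > 0" "\<And>x. x \<in> C \<Longrightarrow> dist x y < \<delta> \<Longrightarrow> s < g x"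
proof -
  have "\<forall>\<^sub>F x in at y within C. s < g x" using assms unfolding lsc_on_iff by blast
  then obtain \<delta> where "\<delta> > 0" "\<And>x. x \<in> C \<Longrightarrow> x \<noteq> y \<Longrightarrow> dist x y < \<delta> \<Longrightarrow> s < g x"
    unfolding eventually_at by auto
  then show ?thesis using that assms(3) by metis
qed

lemma lsc_on_add_continuous:
  assumes "lsc_on C g" "continuous_on C h"
  shows "lsc_on C (\<lambda>x. g x + h x)"
  unfolding lsc_on_iff
proof (intro ballI allI impI)
  fix y s assume y: "y \<in> C" and s: "s < g y + h y"
  define e where "e = (g y + h y - s) / 2"
  have e: "0 < e" using s by (simp add: e_def)
  have "\<forall>\<^sub>F x in at y within C. g y - e < g x"
    using assms(1) y e unfolding lsc_on_iff by simp
  moreover have "\<forall>\<^sub>F x in at y within C. h y - e < h x"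
    using assms(2) y e unfolding continuous_on_def by (intro order_tendstoD(1)) auto
  ultimately show "\<forall>\<^sub>F x in at y within C. s < g x + h x"
  proof eventually_elim
    case (elim x)
    have "g y - e + (h y - e) = s" by (simp add: e_def field_simps)
    with elim show ?case by linarith
  qed
qed

lemma lsc_on_le_of_tendsto:
  fixes C :: "'a::metric_space set"
  assumes "lsc_on C g" "y \<in> C" "v \<longlonglongrightarrow> y" "\<And>n. v n \<in> C" "\<And>n. g (v n) \<le> b n" "b \<longlonglongrightarrow> (l :: real)"
  shows "g y \<le> l"
proof (rule ccontr)
  assume "\<not> g y \<le> l"
  then obtain s where s: "l < s" "s < g y" using dense[of l "g y"] by auto
  obtain \<delta> where \<delta>: "\<delta> > 0" "\<And>x. x \<in> C \<Longrightarrow> dist x y < \<delta> \<Longrightarrow> s < g x"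
    using lsc_on_less[OF assms(1,2) s(2)] by blast
  have "\<forall>\<^sub>F n in sequentially. dist (v n) y < \<delta>" using assms(3) \<delta>(1) by (rule tendstoD)
  moreover have "\<forall>\<^sub>F n in sequentially. b n < s" using assms(6) s(1) by (rule order_tendstoD(2))
  ultimately have "\<forall>\<^sub>F n in sequentially. False"
    by eventually_elim (use \<delta>(2) assms(4,5) in \<open>meson less_asym' order_le_less_trans\<close>)
  then show False by simp
qed

lemma closed_lsc_sublevel:
  fixes C :: "'a::metric_space set"
  assumes "closed C" "lsc_on C g"
  shows "closed {z \<in> C. g z \<le> s}"
  unfolding closed_sequential_limits
proof (intro allI impI)
  fix v l assume v: "(\<forall>n. v n \<in> {z \<in> C. g z \<le> s}) \<and> v \<longlonglongrightarrow> l"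
  then have "l \<in> C" using closed_sequentially[OF assms(1), of v l] by auto
  then have "g l \<le> s" using v by (intro lsc_on_le_of_tendsto[OF assms(2), of l v "\<lambda>_. s" s]) auto
  with \<open>l \<in> C\<close> show "l \<in> {z \<in> C. g z \<le> s}" by simp
qed

lemma convex_on_sublevel:
  assumes "convex_on C g"
  shows "convex {z \<in> C. g z \<le> s}" "convex {z \<in> C. g z < s}"
proof -
  have *: "(1 - u) *\<^sub>R v + u *\<^sub>R w \<in> C \<and> g ((1 - u) *\<^sub>R v + u *\<^sub>R w) \<le> (1 - u) * g v + u * g w"
    if "v \<in> C" "w \<in> C" "0 \<le> u" "u \<le> 1" for u v w
    using convex_onD[OF assms, of u v w] convexD_alt[OF convex_on_imp_convex[OF assms], of v w u] that
    by auto
  show "convex {z \<in> C. g z \<le> s}"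
    unfolding convex_alt
  proof (intro ballI allI impI)
    fix v w u assume h: "v \<in> {z \<in> C. g z \<le> s}" "w \<in> {z \<in> C. g z \<le> s}" "0 \<le> u \<and> u \<le> (1::real)"
    then have "(1 - u) * g v + u * g w \<le> s" by (intro convex_bound_le) auto
    then show "(1 - u) *\<^sub>R v + u *\<^sub>R w \<in> {z \<in> C. g z \<le> s}"
      using h *[of v w u] by auto
  qed
  show "convex {z \<in> C. g z < s}"
    unfolding convex_alt
  proof (intro ballI allI impI)
    fix v w u assume h: "v \<in> {z \<in> C. g z < s}" "w \<in> {z \<in> C. g z < s}" "0 \<le> u \<and> u \<le> (1::real)"
    then have "(1 - u) * g v + u * g w < s" by (intro convex_bound_lt) auto
    then show "(1 - u) *\<^sub>R v + u *\<^sub>R w \<in> {z \<in> C. g z < s}"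
      using h *[of v w u] by auto
  qed
qed

text \<open>If neither function is at least \<open>\<epsilon>\<close> on all of \<open>P\<close>, the weights come from the supremum \<open>\<theta>\<close> of
  \<open>(\<epsilon> - h z) / (g z - \<epsilon>)\<close> over the points with \<open>h z < \<epsilon>\<close>; convexity on segments bounds it by
  \<open>(h w - \<epsilon>) / (\<epsilon> - g w)\<close> for each \<open>w\<close> with \<open>g w < \<epsilon>\<close>.\<close>

lemma convex_pair_alternative:
  assumes g: "convex_on P g" and h: "convex_on P h"
    and alt: "\<And>z. z \<in> P \<Longrightarrow> \<epsilon> \<le> g z \<or> \<epsilon> \<le> h z"
  shows "\<exists>t. 0 \<le> t \<and> t \<le> 1 \<and> (\<forall>z\<in>P. \<epsilon> \<le> t * g z + (1 - t) * h z)"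
proof (cases "(\<forall>z\<in>P. \<epsilon> \<le> h z) \<or> (\<forall>z\<in>P. \<epsilon> \<le> g z)")
  case True
  then show ?thesis
  proof
    assume "\<forall>z\<in>P. \<epsilon> \<le> h z" then show ?thesis by (intro exI[of _ 0]) auto
  next
    assume "\<forall>z\<in>P. \<epsilon> \<le> g z" then show ?thesis by (intro exI[of _ 1]) auto
  qed
next
  case False
  then obtain z0 w0 where z0: "z0 \<in> P" "h z0 < \<epsilon>" and w0: "w0 \<in> P" "g w0 < \<epsilon>"
    by (auto simp: not_le)
  have cross: "(\<epsilon> - h z) * (\<epsilon> - g w) \<le> (g z - \<epsilon>) * (h w - \<epsilon>)"
    if z: "z \<in> P" "h z < \<epsilon>" and w: "w \<in> P" "g w < \<epsilon>" for z w
  proof (rule ccontr)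
    assume not: "\<not> ?thesis"
    define p q r s where "p = g z - \<epsilon>" and "q = \<epsilon> - g w" and "r = \<epsilon> - h z" and "s = h w - \<epsilon>"
    have pos: "0 \<le> p" "0 < q" "0 < r" "0 \<le> s"
      using alt[OF z(1)] alt[OF w(1)] z w by (auto simp: p_def q_def r_def s_def)
    have lt: "p * s < r * q" using not by (simp add: p_def q_def r_def s_def)
    \<comment> \<open>Both functions fall below \<open>\<epsilon>\<close> on the segment if
      \<open>u\<close> lies strictly between \<open>p / (p + q)\<close> and
      \<open>r / (r + s)\<close>. By \<open>lt\<close> these are in the right order, and
      \<open>u\<close> is their mediant.\<close>
    define T u where "T = p + r + q + s" and "u = (p + r) / T"
    have T: "0 < T" using pos by (simp add: T_def)
    have u: "0 \<le> u" "u \<le> 1" using pos T by (auto simp: u_def T_def)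
    have uT: "u * T = p + r" "(1 - u) * T = q + s" using T by (auto simp: u_def T_def field_simps)
    have "((1 - u) * p - u * q) * T = ((1 - u) * T) * p - (u * T) * q" by algebra
    also have "\<dots> = (q + s) * p - (p + r) * q" by (simp only: uT)
    also have "\<dots> < 0" using lt by (simp add: algebra_simps)
    finally have 1: "(1 - u) * p - u * q < 0" using T by (simp add: mult_less_0_iff)
    have "(u * s - (1 - u) * r) * T = (u * T) * s - ((1 - u) * T) * r" by algebra
    also have "\<dots> = (p + r) * s - (q + s) * r" by (simp only: uT)
    also have "\<dots> < 0" using lt by (simp add: algebra_simps)
    finally have 2: "u * s - (1 - u) * r < 0" using T by (simp add: mult_less_0_iff)
    let ?x = "(1 - u) *\<^sub>R z + u *\<^sub>R w"
    have "?x \<in> P" using convexD_alt[OF convex_on_imp_convex[OF g] z(1) w(1), of u] u by simp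
    moreover have "g ?x \<le> (1 - u) * g z + u * g w" using convex_onD[OF g u z(1) w(1)] .
    moreover have "(1 - u) * g z + u * g w = \<epsilon> + ((1 - u) * p - u * q)"
      by (simp add: p_def q_def algebra_simps)
    moreover have "h ?x \<le> (1 - u) * h z + u * h w" using convex_onD[OF h u z(1) w(1)] .
    moreover have "(1 - u) * h z + u * h w = \<epsilon> + (u * s - (1 - u) * r)"
      by (simp add: r_def s_def algebra_simps)
    ultimately show False using alt[of ?x] 1 2 by linarith
  qed
  \<comment> \<open>\<open>alt\<close> gives only a weak inequality; crossing with \<open>w0\<close>
    makes it strict, so the quotients below have positive denominators.\<close>
  have g_pos: "0 < g z - \<epsilon>" if z: "z \<in> P" "h z < \<epsilon>" for z
  proof -
    have "0 < (\<epsilon> - h z) * (\<epsilon> - g w0)" using z w0 by simp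
    then have "0 < (g z - \<epsilon>) * (h w0 - \<epsilon>)" using cross[OF z w0] by linarith
    then show ?thesis using alt[OF z(1)] z(2) by (auto simp: zero_less_mult_iff)
  qed
  let ?R = "(\<lambda>z. (\<epsilon> - h z) / (g z - \<epsilon>)) ` {z \<in> P. h z < \<epsilon>}"
  have le: "(\<epsilon> - h z) / (g z - \<epsilon>) \<le> (h w - \<epsilon>) / (\<epsilon> - g w)"
    if "z \<in> P" "h z < \<epsilon>" "w \<in> P" "g w < \<epsilon>" for z w
    using cross[OF that] g_pos[OF that(1,2)] that(4) by (simp add: field_simps)
  have bdd: "bdd_above ?R" using le[OF _ _ w0] by (intro bdd_aboveI2) auto
  define \<theta> where "\<theta> = Sup ?R"
  have \<theta>_ge: "(\<epsilon> - h z) / (g z - \<epsilon>) \<le> \<theta>" if "z \<in> P" "h z < \<epsilon>" for z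
    unfolding \<theta>_def using that bdd by (intro cSup_upper) auto
  have \<theta>_le: "\<theta> \<le> (h w - \<epsilon>) / (\<epsilon> - g w)" if "w \<in> P" "g w < \<epsilon>" for w
    unfolding \<theta>_def using le[OF _ _ that] z0 by (intro cSup_least) auto
  have \<theta>: "0 \<le> \<theta>" using \<theta>_ge[OF z0] g_pos[OF z0] z0(2) by (smt (verit) divide_nonneg_pos)
  have main: "0 \<le> \<theta> * (g z - \<epsilon>) + (h z - \<epsilon>)" if z: "z \<in> P" for z
  proof -
    consider "h z < \<epsilon>" | "g z < \<epsilon>" | "\<epsilon> \<le> h z" "\<epsilon> \<le> g z" by linarith
    then show ?thesis
    proof cases
      case 1 then show ?thesis using \<theta>_ge[OF z 1] g_pos[OF z 1] by (simp add: pos_divide_le_eq)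
    next
      case 2 then show ?thesis using \<theta>_le[OF z 2] by (simp add: pos_le_divide_eq algebra_simps)
    next
      case 3 then show ?thesis using \<theta> by simp
    qed
  qed
  define t where "t = \<theta> / (1 + \<theta>)"
  have t: "0 \<le> t" "t \<le> 1" "1 - t = 1 / (1 + \<theta>)" using \<theta> by (auto simp: t_def field_simps)
  have "\<epsilon> \<le> t * g z + (1 - t) * h z" if z: "z \<in> P" for z
  proof -
    have "t * g z + (1 - t) * h z = (\<theta> * g z + h z) / (1 + \<theta>)"
      unfolding t(3) by (simp add: t_def add_divide_distrib)
    moreover have "\<epsilon> * (1 + \<theta>) \<le> \<theta> * g z + h z" using main[OF z] by (simp add: algebra_simps)
    then have "\<epsilon> \<le> (\<theta> * g z + h z) / (1 + \<theta>)" using \<theta> by (simp add: pos_le_divide_eq)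
    ultimately show ?thesis by simp
  qed
  then show ?thesis using t by blast
qed

lemma convex_on_sum_fun:
  assumes "finite I" "\<And>i. i \<in> I \<Longrightarrow> convex_on P (g i)" "\<And>i. i \<in> I \<Longrightarrow> 0 \<le> l i" "convex P"
  shows "convex_on P (\<lambda>z. \<Sum>i\<in>I. l i * g i z)"
  using assms(1-3)
proof (induction I)
  case empty
  then show ?case using assms(4) by (simp add: convex_on_const)
next
  case (insert i I)
  then show ?case by (auto intro!: convex_on_add convex_on_cmul)
qed

text \<open>On the part of \<open>P\<close> where \<open>g j\<close> is below
  \<open>\<epsilon>\<close> the other functions satisfy the alternative by themselves. The induction
  hypothesis merges them into one convex function there, and the two-function case joins it with
  \<open>g j\<close> on all of \<open>P\<close>; hence \<open>P\<close> must vary in the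
  induction.\<close>

lemma convex_family_alternative:
  assumes "finite I" "I \<noteq> {}"
    and "\<And>i. i \<in> I \<Longrightarrow> convex_on P (g i)"
    and "\<And>z. z \<in> P \<Longrightarrow> \<exists>i\<in>I. \<epsilon> \<le> g i z"
  shows "\<exists>l. (\<forall>i\<in>I. 0 \<le> l i) \<and> sum l I = 1 \<and> (\<forall>z\<in>P. \<epsilon> \<le> (\<Sum>i\<in>I. l i * g i z))"
  using assms
proof (induction I arbitrary: P rule: finite_ne_induct)
  case (singleton i)
  then show ?case by (intro exI[of _ "\<lambda>_. 1"]) auto
next
  case (insert j I)
  have gj: "convex_on P (g j)" and gI: "\<And>i. i \<in> I \<Longrightarrow> convex_on P (g i)" using insert.prems by auto
  let ?P = "{z \<in> P. g j z < \<epsilon>}"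
  have "convex_on ?P (g i)" if "i \<in> I" for i
    using convex_on_sublevel(2)[OF gj] gI[OF that] by (rule convex_on_subset[rotated -1]) auto
  moreover have "\<exists>i\<in>I. \<epsilon> \<le> g i z" if "z \<in> ?P" for z using insert.prems(2)[of z] that by auto
  ultimately obtain l where l: "\<And>i. i \<in> I \<Longrightarrow> 0 \<le> l i" "sum l I = 1"
      "\<And>z. z \<in> ?P \<Longrightarrow> \<epsilon> \<le> (\<Sum>i\<in>I. l i * g i z)"
    using insert.IH[of ?P] by auto
  have "convex_on P (\<lambda>z. \<Sum>i\<in>I. l i * g i z)"
    using insert.hyps gI l(1) convex_on_imp_convex[OF gj] by (intro convex_on_sum_fun) auto
  then obtain t where t: "0 \<le> t" "t \<le> 1"
      "\<And>z. z \<in> P \<Longrightarrow> \<epsilon> \<le> t * (\<Sum>i\<in>I. l i * g i z) + (1 - t) * g j z"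
    using convex_pair_alternative[OF _ gj, of "\<lambda>z. \<Sum>i\<in>I. l i * g i z" \<epsilon>] l(3) by fastforce
  define l' where "l' i = (if i = j then 1 - t else t * l i)" for i
  have eq: "(\<Sum>i\<in>I. l' i * q i) = t * (\<Sum>i\<in>I. l i * q i)" for q
    unfolding sum_distrib_left using insert.hyps by (intro sum.cong) (auto simp: l'_def)
  have sum_eq: "(\<Sum>i\<in>insert j I. l' i * q i) = t * (\<Sum>i\<in>I. l i * q i) + (1 - t) * q j" for q
    using insert.hyps eq by (simp add: l'_def)
  have "sum l' (insert j I) = 1" using sum_eq[of "\<lambda>_. 1"] l(2) by simp
  moreover have "\<forall>i\<in>insert j I. 0 \<le> l' i" using t l(1) by (auto simp: l'_def)
  ultimately show ?case using t(3) by (intro exI[of _ l']) (simp add: sum_eq)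
qed

text \<open>Otherwise some convex combination of the functions \<open>G y\<close> is at least
  \<open>e\<close> on \<open>C\<close>. At the barycentre of \<open>Y\<close> with the same weights,
  convexity bounds it by a double sum over \<open>Y\<close> that monotonicity makes
  nonpositive.\<close>

lemma monotone_finite_solution:
  fixes G :: "'a::real_vector \<Rightarrow> 'a \<Rightarrow> real"
  assumes C: "convex C" and Y: "finite Y" "Y \<noteq> {}" "Y \<subseteq> C" and e: "0 < e"
    and cv: "\<And>y. y \<in> C \<Longrightarrow> convex_on C (G y)"
    and mono: "\<And>v w. v \<in> C \<Longrightarrow> w \<in> C \<Longrightarrow> G v w + G w v \<le> 0"
  shows "\<exists>z\<in>C. \<forall>y\<in>Y. G y z < e"
proof (rule ccontr)
  assume "\<not> ?thesis"
  then have "\<exists>y\<in>Y. e \<le> G y z" if "z \<in> C" for z using that by (meson not_le)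
  then obtain l where l: "\<And>y. y \<in> Y \<Longrightarrow> 0 \<le> l y" "sum l Y = 1" "\<And>z. z \<in> C \<Longrightarrow> e \<le> (\<Sum>y\<in>Y. l y * G y z)"
    using convex_family_alternative[OF Y(1,2), of C G e] cv Y(3) by blast
  define z where "z = (\<Sum>y\<in>Y. l y *\<^sub>R y)"
  have z: "z \<in> C" unfolding z_def using Y l C by (intro convex_sum) auto
  define T where "T = (\<Sum>y\<in>Y. \<Sum>w\<in>Y. l y * l w * G y w)"
  have "(\<Sum>y\<in>Y. l y * G y z) \<le> (\<Sum>y\<in>Y. l y * (\<Sum>w\<in>Y. l w * G y w))"
    unfolding z_def using Y l by (intro sum_mono mult_left_mono convex_on_sum[OF Y(1,2) cv]) auto
  also have "\<dots> = T" unfolding T_def by (simp add: sum_distrib_left mult.assoc)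
  finally have "e \<le> T" using l(3)[OF z] by simp
  moreover have "T + T \<le> 0"
  proof -
    have "T = (\<Sum>y\<in>Y. \<Sum>w\<in>Y. l y * l w * G w y)"
      unfolding T_def by (subst sum.swap) (simp add: mult.commute)
    then have "T + T = (\<Sum>y\<in>Y. \<Sum>w\<in>Y. l y * l w * (G y w + G w y))"
      unfolding T_def by (simp add: sum.distrib distrib_left)
    also have "\<dots> \<le> 0"
      using l(1) Y(3) mono by (intro sum_nonpos mult_nonneg_nonpos mult_nonneg_nonneg mono) auto
    finally show ?thesis .
  qed
  ultimately show False using e by simp
qed

text \<open>On the segment from \<open>z\<close> to \<open>w\<close>, convexity splits
  \<open>0 = G ?y ?y\<close> into a part at \<open>z\<close>, nonpositive by assumption, and a part
  at \<open>w\<close>, which must therefore be nonnegative.\<close>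

lemma minty_segment:
  fixes G :: "'a::real_vector \<Rightarrow> 'a \<Rightarrow> real"
  assumes C: "z \<in> C" "w \<in> C"
    and diag: "\<And>y. y \<in> C \<Longrightarrow> G y y = 0" and cv: "\<And>y. y \<in> C \<Longrightarrow> convex_on C (G y)"
    and z: "\<And>y. y \<in> C \<Longrightarrow> G y z \<le> 0" and t: "0 < t" "t \<le> 1"
  shows "0 \<le> G (t *\<^sub>R w + (1 - t) *\<^sub>R z) w"
proof -
  let ?y = "(1 - t) *\<^sub>R z + t *\<^sub>R w"
  have y: "?y \<in> C" using convexD_alt[OF convex_on_imp_convex[OF cv[OF C(1)]] C, of t] t by simp
  have "0 \<le> (1 - t) * G ?y z + t * G ?y w"
    using convex_onD[OF cv[OF y], of t z w] diag[OF y] C t by simp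
  also have "\<dots> \<le> t * G ?y w"
    using z[OF y] t by (simp add: mult_nonneg_nonpos)
  finally show ?thesis using t by (simp add: zero_le_mult_iff add.commute)
qed

lemma hemicontinuous_le:
  assumes "Limsup (at_right (0::real)) (\<lambda>t. ereal (g t)) \<le> ereal m"
    and "(h \<longlongrightarrow> l) (at_right 0)" "\<And>t. 0 < t \<Longrightarrow> t \<le> 1 \<Longrightarrow> h t \<le> g t"
  shows "l \<le> m"
proof -
  have "ereal l = Limsup (at_right 0) (\<lambda>t. ereal (h t))"
    using assms(2) by (intro lim_imp_Limsup[symmetric]) auto
  also have "\<dots> \<le> Limsup (at_right 0) (\<lambda>t. ereal (g t))"
    using assms(3) by (intro Limsup_mono) (auto simp: eventually_at_right_field intro!: exI[of _ 1])
  finally show ?thesis using assms(1) by (metis ereal_less_eq(3) order_trans)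
qed

text \<open>Finite systems are solved only up to a positive slack, so the closed sets are indexed by
  pairs \<open>(y, e)\<close>. A finite family is met at its smallest slack, and the full
  intersection removes the slack.\<close>

lemma (in midpoint_convex) monotone_dual_solution:
  fixes C :: "'a set" and G :: "'a \<Rightarrow> 'a \<Rightarrow> real"
  assumes C: "closed C" "convex C"
    and cv: "\<And>y. y \<in> C \<Longrightarrow> convex_on C (G y)" and lsc: "\<And>y. y \<in> C \<Longrightarrow> lsc_on C (G y)"
    and mono: "\<And>v w. v \<in> C \<Longrightarrow> w \<in> C \<Longrightarrow> G v w + G w v \<le> 0"
    and y0: "y0 \<in> C" "bounded {z \<in> C. G y0 z \<le> 1}"
  shows "\<exists>z\<in>C. \<forall>y\<in>C. G y z \<le> 0"
proof -
  define Ks where "Ks = (\<lambda>(y, e). {z \<in> C. G y z \<le> e})"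
  define I where "I = C \<times> {0 :: real<..}"
  have "(\<Inter>i\<in>I. Ks i) \<noteq> {}"
  proof (rule closed_convex_fip[of I Ks "(y0, 1)"])
    show "closed (Ks i)" "convex (Ks i)" if "i \<in> I" for i
      using that closed_lsc_sublevel[OF C(1) lsc] convex_on_sublevel(1)[OF cv]
      by (auto simp: Ks_def I_def)
    show "(y0, 1) \<in> I" "bounded (Ks (y0, 1))" using y0 by (auto simp: Ks_def I_def)
    fix J assume J: "finite J" "J \<subseteq> I"
    show "(\<Inter>i\<in>J. Ks i) \<noteq> {}"
    proof (cases "J = {}")
      case False
      define e where "e = Min (snd ` J)"
      have e: "0 < e" unfolding e_def using J False by (subst Min_gr_iff) (auto simp: I_def)
      have "fst ` J \<subseteq> C" using J by (auto simp: I_def)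
      then obtain z where z: "z \<in> C" "\<And>y. y \<in> fst ` J \<Longrightarrow> G y z < e"
        using monotone_finite_solution[OF C(2) _ _ _ e cv mono, of "fst ` J"] J False by auto
      have "z \<in> Ks i" if "i \<in> J" for i
      proof -
        have "G (fst i) z < e" using z(2) that by blast
        also have "e \<le> snd i" unfolding e_def using that J by (intro Min_le) auto
        finally show ?thesis using z(1) by (simp add: Ks_def case_prod_beta)
      qed
      then show ?thesis by blast
    qed simp
  qed
  then obtain z where z: "\<And>y e. y \<in> C \<Longrightarrow> 0 < e \<Longrightarrow> z \<in> C \<and> G y z \<le> e"
    by (auto simp: Ks_def I_def)
  have "G y z \<le> 0" if "y \<in> C" for y
  proof (rule field_le_epsilon)
    fix e :: real assume "0 < e"
    then show "G y z \<le> 0 + e" using z[OF that] by simp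
  qed
  with z[OF y0(1), of 1] show ?thesis by auto
qed

text \<open>A substitute for a supporting functional: linear lower growth, which a quadratic term
  will dominate. Semicontinuity controls \<open>g\<close> near \<open>y\<close>, and convexity
  extends the bound outward.\<close>

lemma convex_on_lsc_linear_lower:
  fixes C :: "'a::real_normed_vector set"
  assumes cv: "convex_on C g" and lsc: "lsc_on C g" and y: "y \<in> C"
  obtains B where "B \<ge> 0" "\<And>z. z \<in> C \<Longrightarrow> g y - 1 - B * norm (z - y) \<le> g z"
proof -
  obtain \<delta> where \<delta>: "\<delta> > 0" "\<And>x. x \<in> C \<Longrightarrow> dist x y < \<delta> \<Longrightarrow> g y - 1 < g x"
    using lsc_on_less[OF lsc y, of "g y - 1"] by auto
  have "g y - 1 - 2 / \<delta> * norm (z - y) \<le> g z" if z: "z \<in> C" for z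
  proof (cases "norm (z - y) < \<delta>")
    case True
    then have "g y - 1 < g z" using \<delta>(2)[OF z] by (simp add: dist_norm)
    moreover have "0 \<le> 2 / \<delta> * norm (z - y)" using \<delta>(1) by simp
    ultimately show ?thesis by linarith
  next
    case False
    \<comment> \<open>Pulls \<open>z\<close> back to distance \<open>\<delta> / 2\<close> from
      \<open>y\<close>, inside the ball where \<open>g\<close> is controlled.\<close>
    define s where "s = \<delta> / (2 * norm (z - y))"
    have n: "0 < norm (z - y)" using False \<delta>(1) by linarith
    have s: "0 < s" "s \<le> 1" using \<delta>(1) False n by (auto simp: s_def field_simps)
    let ?w = "(1 - s) *\<^sub>R y + s *\<^sub>R z"
    have w: "?w \<in> C" using convexD_alt[OF convex_on_imp_convex[OF cv] y z, of s] s by simp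
    have "?w - y = s *\<^sub>R (z - y)" by (simp add: algebra_simps)
    then have "norm (?w - y) = s * norm (z - y)" using s by simp
    also have "\<dots> < \<delta>" using n \<delta>(1) by (simp add: s_def)
    finally have "g y - 1 < g ?w" by (intro \<delta>(2) w) (simp add: dist_norm)
    also have "g ?w \<le> (1 - s) * g y + s * g z" using convex_onD[OF cv, of s y z] s y z by simp
    finally have "s * (g y - g z) \<le> 1" by (simp add: algebra_simps)
    then have "g y - g z \<le> 1 / s" using s by (simp add: field_simps)
    also have "1 / s = 2 / \<delta> * norm (z - y)" by (simp add: s_def)
    finally show ?thesis by simp
  qed
  then show ?thesis using that[of "2 / \<delta>"] \<delta>(1) by simp
qed

section \<open>Existence, uniqueness and Lyapunov estimates of resolvents\<close>

context smooth_convex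
begin

context
  fixes C :: "'a set" and f
  assumes C: "closed C" "C \<noteq> {}"
    and A1: "\<And>v. v \<in> C \<Longrightarrow> f v v = 0"
    and A2: "\<And>v w. v \<in> C \<Longrightarrow> w \<in> C \<Longrightarrow> f v w + f w v \<le> 0"
    and A3: "\<And>v w s. v \<in> C \<Longrightarrow> w \<in> C \<Longrightarrow> s \<in> C \<Longrightarrow>
               Limsup (at_right (0::real)) (\<lambda>t. ereal (f (t *\<^sub>R s + (1 - t) *\<^sub>R v) w)) \<le> ereal (f v w)"
    and A4: "\<And>v. v \<in> C \<Longrightarrow> convex_on C (f v)" "\<And>v. v \<in> C \<Longrightarrow> lsc_on C (f v)"
begin

lemma resolvent_exists:
  assumes r: "0 < r"
  shows "\<exists>z\<in>C. \<forall>y\<in>C. f z y + 1 / r * (duality_map z - duality_map x) (y - z) \<ge> 0"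
proof -
  define H where "H v z = f v z + 1 / r * (duality_map v - duality_map x) (z - v)" for v z
  define m where "m = \<mu> / r"
  \<comment> \<open>The quadratic term uses up half of the strong monotonicity of the duality mapping
    and makes the sublevel sets of \<open>G v\<close> bounded.\<close>
  define G where "G v z = H v z + m * (norm (z - v))\<^sup>2" for v z
  have m: "0 < m" using r \<mu>_pos by (simp add: m_def)
  have cvC: "convex C" using A4(1) C(2) convex_on_imp_convex by blast
  have cvL: "convex_on C (\<lambda>z. k * (g :: 'a \<Rightarrow>\<^sub>L real) (z - v))" for k g v
    by (rule convex_onI[OF _ cvC])
      (simp add: blinfun.diff_right blinfun.add_right blinfun.scaleR_right algebra_simps)
  have cvH: "convex_on C (H v)" if "v \<in> C" for v
    unfolding H_def using A4(1)[OF that] cvL by (intro convex_on_add)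
  have cvN: "convex_on C (\<lambda>z. (norm (z - v))\<^sup>2)" for v
  proof (rule convex_onI[OF _ cvC])
    fix t :: real and a b assume t: "0 < t" "t < 1"
    have "(1 - t) *\<^sub>R a + t *\<^sub>R b - v = (1 - t) *\<^sub>R (a - v) + t *\<^sub>R (b - v)"
      by (simp add: algebra_simps)
    then show "(norm ((1 - t) *\<^sub>R a + t *\<^sub>R b - v))\<^sup>2 \<le> (1 - t) * (norm (a - v))\<^sup>2 + t * (norm (b - v))\<^sup>2"
      using norm_square_convex[of t "a - v" "b - v"] t by simp
  qed
  have cvG: "convex_on C (G v)" if "v \<in> C" for v
    unfolding G_def using cvH[OF that] cvN m by (intro convex_on_add convex_on_cmul) auto
  have lscG: "lsc_on C (G v)" if "v \<in> C" for v
    unfolding G_def H_def add.assoc using A4(2)[OF that]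
    by (intro lsc_on_add_continuous continuous_intros) auto
  have monoG: "G v w + G w v \<le> 0" if "v \<in> C" "w \<in> C" for v w
  proof -
    have "1 / r * (2 * \<mu> * (norm (v - w))\<^sup>2) \<le> 1 / r * (duality_map v - duality_map w) (v - w)"
      using J_strongly_monotone[of v w] r by (intro mult_left_mono) auto
    moreover have "G v w + G w v = f v w + f w v - 1 / r * (duality_map v - duality_map w) (v - w)
        + 1 / r * (2 * \<mu> * (norm (v - w))\<^sup>2)"
      using r unfolding G_def H_def m_def
      by (simp add: blinfun.diff_left blinfun.diff_right norm_minus_commute field_simps)
    ultimately show ?thesis using A2[OF that] by linarith
  qed
  obtain y0 where y0: "y0 \<in> C" using C(2) by blast
  obtain B where B: "B \<ge> 0" "\<And>z. z \<in> C \<Longrightarrow> f y0 y0 - 1 - B * norm (z - y0) \<le> f y0 z"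
    using convex_on_lsc_linear_lower[OF A4(1)[OF y0] A4(2)[OF y0] y0] by blast
  define B' where "B' = B + norm (duality_map y0 - duality_map x) / r"
  have B': "0 \<le> B'" using B r by (simp add: B'_def)
  have bdd: "bounded {z \<in> C. G y0 z \<le> 1}"
  proof (rule boundedI)
    fix z assume z: "z \<in> {z \<in> C. G y0 z \<le> 1}"
    let ?s = "norm (z - y0)"
    have "- (norm (duality_map y0 - duality_map x) * ?s) \<le> (duality_map y0 - duality_map x) (z - y0)"
      using norm_blinfun[of "duality_map y0 - duality_map x" "z - y0"] by (simp add: abs_le_iff)
    then have "1 / r * - (norm (duality_map y0 - duality_map x) * ?s)
        \<le> 1 / r * (duality_map y0 - duality_map x) (z - y0)"
      using r by (intro mult_left_mono) auto
    then have "- 1 - B' * ?s + m * ?s\<^sup>2 \<le> G y0 z"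
      using B(2)[of z] z A1[OF y0] unfolding G_def H_def B'_def by (simp add: algebra_simps)
    then have *: "m * ?s\<^sup>2 \<le> 2 + B' * ?s" using z by simp
    have "?s \<le> 1 + (2 + B') / m"
    proof (cases "?s \<le> 1")
      case True
      moreover have "0 \<le> (2 + B') / m" using m B' by simp
      ultimately show ?thesis by linarith
    next
      case False
      then have "m * ?s * ?s \<le> (2 + B') * ?s"
        using * by (simp add: power2_eq_square algebra_simps)
      then have "m * ?s \<le> 2 + B'"
        by (rule mult_right_le_imp_le) (use False in linarith)
      then have "?s \<le> (2 + B') / m" using m by (simp add: field_simps)
      then show ?thesis by simp
    qed
    then show "norm z \<le> 1 + (2 + B') / m + norm y0"
      using norm_triangle_sub[of z y0] by linarith
  qed
  obtain z where z: "z \<in> C" "\<And>y. y \<in> C \<Longrightarrow> G y z \<le> 0"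
    using monotone_dual_solution[OF C(1) cvC cvG lscG monoG y0 bdd] by blast
  have Hz: "H y z \<le> 0" if "y \<in> C" for y
  proof -
    have "0 \<le> m * (norm (z - y))\<^sup>2" using m by simp
    then show ?thesis using z(2)[OF that] unfolding G_def by linarith
  qed
  have "0 \<le> f z w + 1 / r * (duality_map z - duality_map x) (w - z)" if w: "w \<in> C" for w
  proof -
    define q where "q t = t *\<^sub>R w + (1 - t) *\<^sub>R z" for t
    define h where "h t = - (1 / r * (duality_map (q t) - duality_map x) (w - q t))" for t
    have "(q \<longlongrightarrow> 0 *\<^sub>R w + (1 - 0) *\<^sub>R z) (at_right 0)" unfolding q_def by (intro tendsto_intros)
    then have q: "(q \<longlongrightarrow> z) (at_right 0)" by simp
    have lim: "(h \<longlongrightarrow> - (1 / r * (duality_map z - duality_map x) (w - z))) (at_right 0)"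
      unfolding h_def by (intro tendsto_intros blinfun.tendsto J_tendsto q)
    have le: "h t \<le> f (q t) w" if "0 < t" "t \<le> 1" for t
      using minty_segment[of z C w H, OF z(1) w _ cvH Hz that] A1
      by (simp add: H_def h_def q_def)
    have "Limsup (at_right 0) (\<lambda>t. ereal (f (q t) w)) \<le> ereal (f z w)"
      unfolding q_def by (rule A3[OF z(1) w w])
    from hemicontinuous_le[OF this lim le]
    have "- (1 / r * (duality_map z - duality_map x) (w - z)) \<le> f z w" .
    then show ?thesis by simp
  qed
  with z(1) show ?thesis by blast
qed

text \<open>The definite description also requires uniqueness: each of two solutions is tested
  against the other, and the sum contradicts strong monotonicity of the duality mapping unless they
  agree.\<close>

lemma
  assumes r: "0 < r"
  shows resolvent_in: "resolvent C f r x \<in> C"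
    and resolvent_ineq: "y \<in> C \<Longrightarrow>
      0 \<le> f (resolvent C f r x) y
        + 1 / r * (duality_map (resolvent C f r x) - duality_map x) (y - resolvent C f r x)"
proof -
  let ?P = "\<lambda>z. z \<in> C \<and> (\<forall>y\<in>C. f z y + 1 / r * (duality_map z - duality_map x) (y - z) \<ge> 0)"
  have "\<exists>!z. ?P z"
  proof (rule ex_ex1I)
    show "\<exists>z. ?P z" using resolvent_exists[OF r] by blast
    fix z z' assume z: "?P z" and z': "?P z'"
    have "0 \<le> f z z' + 1 / r * (duality_map z - duality_map x) (z' - z)"
      "0 \<le> f z' z + 1 / r * (duality_map z' - duality_map x) (z - z')" using z z' by auto
    moreover have "1 / r * (duality_map z - duality_map x) (z' - z)
        + 1 / r * (duality_map z' - duality_map x) (z - z')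
        = - (1 / r * (duality_map z - duality_map z') (z - z'))"
      using r by (simp add: blinfun.diff_left blinfun.diff_right field_simps)
    ultimately have "1 / r * (duality_map z - duality_map z') (z - z') \<le> 0"
      using A2[of z z'] z z' by linarith
    then have "2 * \<mu> * (norm (z - z'))\<^sup>2 \<le> 0"
      using J_strongly_monotone[of z z'] r by (simp add: divide_le_0_iff)
    then show "z = z'" using \<mu>_pos by (simp add: mult_le_0_iff)
  qed
  then have "?P (resolvent C f r x)" unfolding resolvent_def by (rule theI')
  then show "resolvent C f r x \<in> C" "y \<in> C \<Longrightarrow>
      0 \<le> f (resolvent C f r x) y
        + 1 / r * (duality_map (resolvent C f r x) - duality_map x) (y - resolvent C f r x)"
    by auto
qed

text \<open>Testing the resolvent inequality at \<open>q\<close> leaves only the duality term, since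
  monotonicity of \<open>f\<close> makes \<open>f ?z q\<close> nonpositive; its sign feeds the
  three-point identity.\<close>

lemma lyapunov_resolvent:
  assumes r: "0 < r" and q: "q \<in> EP C f"
  shows "lyapunov q (resolvent C f r v) \<le> lyapunov q v"
proof -
  let ?z = "resolvent C f r v"
  have q: "q \<in> C" "0 \<le> f q ?z" using q resolvent_in[OF r] by (auto simp: EP_def)
  have "f ?z q \<le> 0" using A2[OF q(1) resolvent_in[OF r, of v]] q(2) by linarith
  then have "0 \<le> 1 / r * (duality_map ?z - duality_map v) (q - ?z)"
    using resolvent_ineq[OF r q(1), of v] by linarith
  then have "0 \<le> (duality_map ?z - duality_map v) (q - ?z)"
    using r by (simp add: zero_le_divide_iff)
  then show ?thesis
    using three_point[of q v ?z] lyapunov_nonneg[OF smooth, of ?z v] by linarith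
qed

text \<open>Semicontinuity is available in the second argument of \<open>f\<close>, while the
  resolvents sit in the first. So (A2) swaps the arguments, the limit is taken in the dual
  inequality, and Minty's argument swaps back. The bound \<open>d\<close> controls the factors
  \<open>1 / r n\<close>.\<close>

lemma EP_of_limit:
  assumes r: "0 < d" "\<And>n. d \<le> r n"
    and v: "v \<longlonglongrightarrow> p" and u: "(\<lambda>n. resolvent C f (r n) (v n)) \<longlonglongrightarrow> p"
  shows "p \<in> EP C f"
proof -
  define u where "u n = resolvent C f (r n) (v n)" for n
  have rn: "0 < r n" for n using r(1) r(2)[of n] by linarith
  have uC: "u n \<in> C" for n unfolding u_def by (rule resolvent_in[OF rn])
  have up: "u \<longlonglongrightarrow> p" using u unfolding u_def .
  have pC: "p \<in> C" using closed_sequentially[OF C(1)] uC up by blast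
  have dual: "f w p \<le> 0" if w: "w \<in> C" for w
  proof -
    let ?e = "\<lambda>n. (duality_map (u n) - duality_map (v n)) (w - u n)"
    have "f w (u n) \<le> \<bar>?e n\<bar> / d" for n
    proof -
      have "f w (u n) \<le> 1 / r n * ?e n"
        using resolvent_ineq[OF rn w, of n "v n"] A2[OF w uC[of n]] unfolding u_def by linarith
      also have "\<dots> \<le> \<bar>?e n\<bar> / r n" using rn[of n] by (simp add: divide_right_mono)
      also have "\<dots> \<le> \<bar>?e n\<bar> / d" using r(1) r(2)[of n] rn[of n] by (intro divide_left_mono) auto
      finally show ?thesis .
    qed
    moreover have "(\<lambda>n. \<bar>?e n\<bar> / d) \<longlonglongrightarrow> \<bar>(duality_map p - duality_map p) (w - p)\<bar> / d"
      using r(1) by (intro tendsto_intros blinfun.tendsto J_tendsto v up) auto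
    ultimately have "f w p \<le> \<bar>(duality_map p - duality_map p) (w - p)\<bar> / d"
      by (intro lsc_on_le_of_tendsto[OF A4(2)[OF w] pC up uC])
    then show ?thesis by simp
  qed
  have "0 \<le> f p w" if w: "w \<in> C" for w
    using hemicontinuous_le[OF A3[OF pC w w] tendsto_const]
      minty_segment[of p C w f, OF pC w A1 A4(1) dual] by blast
  with pC show ?thesis by (simp add: EP_def)
qed

end

end

section \<open>The hybrid iteration\<close>

lemma tendsto_of_norm_le:
  fixes v w :: "nat \<Rightarrow> 'a::real_normed_vector"
  assumes "v \<longlonglongrightarrow> p" "b \<longlonglongrightarrow> 0" "\<forall>\<^sub>F n in sequentially. norm (w n - v n) \<le> b n"
  shows "w \<longlonglongrightarrow> p"
proof -
  have "(\<lambda>n. w n - v n) \<longlonglongrightarrow> 0"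
    by (rule Lim_null_comparison[OF assms(3,2)])
  from tendsto_add[OF this assms(1)] show ?thesis by simp
qed

text \<open>As \<open>L\<close> is independent of \<open>n\<close>, replacing \<open>v n\<close> by
  \<open>p\<close> gives that \<open>(T ^^ n) p\<close> converges to \<open>p\<close>; applying
  \<open>T\<close> once more shows that \<open>T p\<close> and \<open>p\<close> are limits of the
  same sequence.\<close>

lemma fixed_point_of_asymptotic:
  fixes C :: "'a::real_normed_vector set"
  assumes lip: "uniformly_lipschitz_on C L T" and p: "p \<in> C" and T: "T \<in> C \<rightarrow> C"
    and v: "v \<longlonglongrightarrow> p" "\<And>n. v n \<in> C" and Tv: "(\<lambda>n. (T ^^ n) (v n)) \<longlonglongrightarrow> p"
  shows "T p = p"
proof -
  have Lip: "norm ((T ^^ n) a - (T ^^ n) b) \<le> L * norm (a - b)" if "1 \<le> n" "a \<in> C" "b \<in> C" for n a b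
    using lip that unfolding uniformly_lipschitz_on_def lipschitz_on_def by (auto simp: dist_norm)
  have Tn: "(T ^^ n) p \<in> C" for n using T p by (induction n) auto
  have "(\<lambda>n. L * norm (p - v n)) \<longlonglongrightarrow> L * norm (p - p)" by (intro tendsto_intros v)
  then have "(\<lambda>n. L * norm (p - v n)) \<longlonglongrightarrow> 0" by simp
  then have lim: "(\<lambda>n. (T ^^ n) p) \<longlonglongrightarrow> p"
    by (rule tendsto_of_norm_le[OF Tv])
      (use Lip p v(2) in \<open>auto simp: eventually_sequentially intro!: exI[of _ 1]\<close>)
  have "(\<lambda>n. L * norm ((T ^^ n) p - p)) \<longlonglongrightarrow> L * norm (p - p)" by (intro tendsto_intros lim)
  then have "(\<lambda>n. L * norm ((T ^^ n) p - p)) \<longlonglongrightarrow> 0" by simp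
  then have "(\<lambda>n. T ((T ^^ n) p)) \<longlonglongrightarrow> T p"
    by (rule tendsto_of_norm_le[OF tendsto_const])
      (use Lip[of 1] p Tn in simp)
  moreover have "(\<lambda>n. T ((T ^^ n) p)) \<longlonglongrightarrow> p" using LIMSEQ_Suc[OF lim] by simp
  ultimately show ?thesis by (rule LIMSEQ_unique)
qed

lemma inverse_strongly_monotone_lipschitz:
  assumes "inverse_strongly_monotone C \<alpha> B" "0 < \<alpha>" "v \<in> C" "w \<in> C"
  shows "norm (B v - B w) \<le> norm (v - w) / \<alpha>"
proof (cases "B v = B w")
  case False
  have "\<alpha> * (norm (B v - B w))\<^sup>2 \<le> (B v - B w) (v - w)"
    using assms unfolding inverse_strongly_monotone_def by blast
  also have "\<dots> \<le> norm (B v - B w) * norm (v - w)"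
    using norm_blinfun[of "B v - B w" "v - w"] by simp
  finally have "norm (B v - B w) * (\<alpha> * norm (B v - B w)) \<le> norm (B v - B w) * norm (v - w)"
    by (simp add: power2_eq_square algebra_simps)
  then have "\<alpha> * norm (B v - B w) \<le> norm (v - w)" using False by simp
  then show ?thesis using assms(2) by (simp add: field_simps)
qed (use assms in simp)

section \<open>Lyapunov estimates for the steps of the iteration\<close>

context smooth_convex
begin

text \<open>The squared norm of \<open>v\<close> cancels, leaving a half-space. This is what keeps
  the sets \<open>Cs n\<close> closed and convex.\<close>

lemma lyapunov_halfspace:
  assumes "closed D" "convex D"
  shows "closed {v \<in> D. lyapunov v w \<le> lyapunov v w' + e}" (is "closed ?S")
    and "convex {v \<in> D. lyapunov v (w :: 'a) \<le> lyapunov v w' + e}"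
proof -
  let ?g = "duality_map w' - duality_map w" and ?k = "((norm w')\<^sup>2 - (norm w)\<^sup>2 + e) / 2"
  have eq: "?S = D \<inter> {v. ?g v \<le> ?k}"
    by (auto simp: lyapunov_def blinfun.diff_left field_simps)
  have "closed {v. ?g v \<le> ?k}"
    by (intro closed_Collect_le continuous_intros)
  then show "closed ?S" unfolding eq using assms by (intro closed_Int)
  have "convex {v. g v \<le> k}" for g :: "'a \<Rightarrow>\<^sub>L real" and k
    by (auto simp: convex_def blinfun.add_right blinfun.scaleR_right intro!: convex_bound_le)
  then show "convex ?S" unfolding eq using assms by (intro convex_Int)
qed

text \<open>For fixed \<open>q\<close>, \<open>lyapunov q z\<close> is a convex function of
  \<open>duality_map z\<close>.\<close>

lemma lyapunov_J_combination:
  fixes v w q :: 'a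
  assumes t: "0 \<le> t" "t \<le> 1"
  defines "z \<equiv> duality_map_inv (t *\<^sub>R duality_map v + (1 - t) *\<^sub>R duality_map w)"
  shows "lyapunov q z \<le> t * lyapunov q v + (1 - t) * lyapunov q w"
proof -
  have Jz: "duality_map z = t *\<^sub>R duality_map v + (1 - t) *\<^sub>R duality_map w" by (simp add: z_def)
  have "(norm z)\<^sup>2 \<le> t * (norm v)\<^sup>2 + (1 - t) * (norm w)\<^sup>2"
    using norm_square_convex[OF t, of "duality_map w" "duality_map v"]
    unfolding J_norm[symmetric] Jz by (simp add: add.commute)
  then show ?thesis
    by (simp add: lyapunov_def Jz blinfun.add_left blinfun.diff_left blinfun.scaleR_left algebra_simps)
qed

lemma J_step_close:
  assumes "0 \<le> s"
  shows "norm (duality_map_inv (duality_map v - s *\<^sub>R g) - (v :: 'a)) \<le> 2 / (two_uc_c TYPE('a))\<^sup>2 * (s * norm g)"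
  using two_uc_c_le[of "duality_map_inv (duality_map v - s *\<^sub>R g)" v] assms by simp

text \<open>The three-point identity leaves \<open>2 * s * B v (q - w)\<close>. Splitting at
  \<open>v\<close>, the part toward \<open>q\<close> yields the gain from inverse strong
  monotonicity, and the displacement \<open>v - w\<close> costs the term with
  \<open>two_uc_c\<close>.\<close>

lemma lyapunov_VI_step:
  fixes v q :: 'a
  assumes C: "closed C" "convex C" "v \<in> C" and ism: "inverse_strongly_monotone C \<alpha> B" "0 < \<alpha>"
    and q: "q \<in> VI B C" "norm (B v) \<le> norm (B v - B q)" and s: "0 \<le> s"
  shows "lyapunov q (gen_proj C (duality_map_inv (duality_map v - s *\<^sub>R B v)))
     \<le> lyapunov q v - 2 * s * (\<alpha> - 2 * s / (two_uc_c TYPE('a))\<^sup>2) * (norm (B v))\<^sup>2"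
proof -
  define w where "w = duality_map_inv (duality_map v - s *\<^sub>R B v)"
  have Jw: "duality_map w = duality_map v - s *\<^sub>R B v" by (simp add: w_def)
  have qC: "q \<in> C" and Bq: "0 \<le> B q (v - q)" using q(1) C(3) by (auto simp: VI_def)
  have "lyapunov q (gen_proj C w) \<le> lyapunov q w"
    using lyapunov_gen_proj[OF C(1,2) qC, of w] lyapunov_nonneg[OF smooth, of "gen_proj C w" w] by linarith
  also have "\<dots> \<le> lyapunov q v + 2 * s * B v (q - w)"
    using three_point[of q v w] lyapunov_nonneg[OF smooth, of w v]
    by (simp add: Jw blinfun.minus_left blinfun.scaleR_left)
  also have "B v (q - w) = - (B v - B q) (v - q) - B q (v - q) + B v (v - w)"
    by (simp add: blinfun.diff_left blinfun.diff_right)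
  also have "2 * s * \<dots> \<le> 2 * s * (- (\<alpha> * (norm (B v))\<^sup>2) + 2 / (two_uc_c TYPE('a))\<^sup>2 * s * (norm (B v))\<^sup>2)"
  proof -
    have "\<alpha> * (norm (B v - B q))\<^sup>2 \<le> (B v - B q) (v - q)"
      using ism(1) C(3) qC unfolding inverse_strongly_monotone_def by blast
    moreover have "\<alpha> * (norm (B v))\<^sup>2 \<le> \<alpha> * (norm (B v - B q))\<^sup>2"
      using q(2) ism(2) by (intro mult_left_mono power_mono) auto
    moreover have "B v (v - w) \<le> 2 / (two_uc_c TYPE('a))\<^sup>2 * s * (norm (B v))\<^sup>2"
    proof -
      have "B v (v - w) \<le> norm (B v) * norm (w - v)"
        using norm_blinfun[of "B v" "v - w"] by (simp add: norm_minus_commute)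
      also have "\<dots> \<le> norm (B v) * (2 / (two_uc_c TYPE('a))\<^sup>2 * (s * norm (B v)))"
        using J_step_close[OF s, of v "B v"] unfolding w_def by (intro mult_left_mono) auto
      finally show ?thesis by (simp add: power2_eq_square algebra_simps)
    qed
    ultimately show ?thesis using s Bq by (intro mult_left_mono) linarith+
  qed
  finally show ?thesis unfolding w_def by (simp add: algebra_simps)
qed

text \<open>Dividing the variational inequality of the projection by \<open>s n\<close> leaves an
  error bounded by \<open>\<bar>?e n\<bar> / a\<close>, so the step sizes themselves need not
  converge.\<close>

lemma VI_of_limit:
  fixes v y :: "nat \<Rightarrow> 'a"
  assumes C: "closed C" "convex C" and ism: "inverse_strongly_monotone C \<alpha> B" "0 < \<alpha>"
    and v: "\<And>n. v n \<in> C" "v \<longlonglongrightarrow> p" and y: "y \<longlonglongrightarrow> p"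
      "\<And>n. y n = gen_proj C (duality_map_inv (duality_map (v n) - s n *\<^sub>R B (v n)))"
    and a: "0 < a" "\<And>n. a \<le> s n"
  shows "p \<in> VI B C"
proof -
  have pC: "p \<in> C" using closed_sequentially[OF C(1)] v by blast
  then have ne: "C \<noteq> {}" by blast
  have "(\<lambda>n. norm (v n - p) / \<alpha>) \<longlonglongrightarrow> norm (p - p) / \<alpha>" using ism(2) by (intro tendsto_intros v) auto
  then have "(\<lambda>n. norm (v n - p) / \<alpha>) \<longlonglongrightarrow> 0" by simp
  then have B: "(\<lambda>n. B (v n)) \<longlonglongrightarrow> B p"
    by (rule tendsto_of_norm_le[OF tendsto_const])
      (use inverse_strongly_monotone_lipschitz[OF ism v(1) pC] in simp)
  have "0 \<le> B p (w - p)" if w: "w \<in> C" for w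
  proof -
    let ?e = "\<lambda>n. (duality_map (v n) - duality_map (y n)) (w - y n)"
    have "- (\<bar>?e n\<bar> / a) \<le> B (v n) (w - y n)" for n
    proof -
      have "?e n - s n * B (v n) (w - y n) \<le> 0"
        using gen_proj_variational[OF C ne w, of "duality_map_inv (duality_map (v n) - s n *\<^sub>R B (v n))"]
        unfolding y(2)[symmetric] by (simp add: blinfun.diff_left blinfun.scaleR_left)
      then have "?e n / s n \<le> B (v n) (w - y n)"
        using a(1) a(2)[of n] by (simp add: pos_divide_le_eq mult.commute)
      moreover have "\<bar>?e n\<bar> / s n \<le> \<bar>?e n\<bar> / a"
        using a(1) a(2)[of n] by (intro divide_left_mono) auto
      moreover have "- (\<bar>?e n\<bar> / s n) \<le> ?e n / s n"
        using divide_right_mono[of "- \<bar>?e n\<bar>" "?e n" "s n"] a(1) a(2)[of n] by simp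
      ultimately show ?thesis by linarith
    qed
    moreover have "(\<lambda>n. - (\<bar>?e n\<bar> / a)) \<longlonglongrightarrow> - (\<bar>(duality_map p - duality_map p) (w - p)\<bar> / a)"
      using a(1) by (intro tendsto_intros blinfun.tendsto J_tendsto v y) auto
    moreover have "(\<lambda>n. B (v n) (w - y n)) \<longlonglongrightarrow> B p (w - p)"
      by (intro tendsto_intros blinfun.tendsto B y)
    ultimately have "- (\<bar>(duality_map p - duality_map p) (w - p)\<bar> / a) \<le> B p (w - p)"
      by (intro LIMSEQ_le) auto
    then show ?thesis by simp
  qed
  with pC show ?thesis by (simp add: VI_def)
qed

end

theorem theorem3p1:
  fixes C :: "'a::banach set"
    and A :: "nat \<Rightarrow> 'a \<Rightarrow> ('a \<Rightarrow>\<^sub>L real)"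
    and f :: "nat \<Rightarrow> 'a \<Rightarrow> 'a \<Rightarrow> real"
    and S :: "nat \<Rightarrow> 'a \<Rightarrow> 'a"
    and M K N :: nat
    and \<alpha> L \<omega> a b c d :: real
    and \<alpha>s lams rs ks \<epsilon>s :: "nat \<Rightarrow> real"
    and F :: "'a set" and Cs :: "nat \<Rightarrow> 'a set"
    and x ybar zbar ubar :: "nat \<Rightarrow> 'a"
    and y z u :: "nat \<Rightarrow> nat \<Rightarrow> 'a"
    and im jm lm :: "nat \<Rightarrow> nat"
  assumes smooth: "uniformly_smooth TYPE('a)"
    and uconvex: "two_uniformly_convex TYPE('a)"
    and c_def: "c = two_uc_c TYPE('a)"
    and C: "C \<noteq> {}" "closed C" "convex C"
    and MKN: "M \<ge> 1" "K \<ge> 1" "N \<ge> 1"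
    and \<alpha>_pos: "\<alpha> > 0"
    and V1: "\<And>i. i \<in> {1..M} \<Longrightarrow> inverse_strongly_monotone C \<alpha> (A i)"
    and V2: "\<And>i. i \<in> {1..M} \<Longrightarrow> VI (A i) C \<noteq> {}"
    and V3: "\<And>i v w. i \<in> {1..M} \<Longrightarrow> v \<in> C \<Longrightarrow> w \<in> VI (A i) C \<Longrightarrow>
               norm (A i v) \<le> norm (A i v - A i w)"
    and A1: "\<And>k v. k \<in> {1..K} \<Longrightarrow> v \<in> C \<Longrightarrow> f k v v = 0"
    and A2: "\<And>k v w. k \<in> {1..K} \<Longrightarrow> v \<in> C \<Longrightarrow> w \<in> C \<Longrightarrow> f k v w + f k w v \<le> 0"
    and A3: "\<And>k v w s. k \<in> {1..K} \<Longrightarrow> v \<in> C \<Longrightarrow> w \<in> C \<Longrightarrow> s \<in> C \<Longrightarrow>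
               Limsup (at_right (0::real)) (\<lambda>t. ereal (f k (t *\<^sub>R s + (1 - t) *\<^sub>R v) w))
                 \<le> ereal (f k v w)"
    and A4: "\<And>k v. k \<in> {1..K} \<Longrightarrow> v \<in> C \<Longrightarrow> convex_on C (f k v) \<and> lsc_on C (f k v)"
    and S_self: "\<And>j. j \<in> {1..N} \<Longrightarrow> S j \<in> C \<rightarrow> C"
    and L_pos: "L > 0"
    and S_lip: "\<And>j. j \<in> {1..N} \<Longrightarrow> uniformly_lipschitz_on C L (S j)"
    and ks: "\<And>n. ks n \<ge> 1" "ks \<longlonglongrightarrow> 1"
    and S_qpan: "\<And>j. j \<in> {1..N} \<Longrightarrow> quasi_phi_asymp_nonexpansive C ks (S j)"
    and F_def: "F = (\<Inter>i\<in>{1..M}. VI (A i) C) \<inter> (\<Inter>j\<in>{1..N}. fixed_points C (S j))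
                      \<inter> (\<Inter>k\<in>{1..K}. EP C (f k))"
    and F_nonempty: "F \<noteq> {}"
    and F_bounded: "\<omega> > 0" "F \<subseteq> {v \<in> C. norm v \<le> \<omega>}"
    and \<alpha>s: "\<And>n. 0 \<le> \<alpha>s n \<and> \<alpha>s n \<le> 1" "limsup (\<lambda>n. ereal (\<alpha>s n)) < 1"
    and ab: "a \<in> {0<..<\<alpha> * c\<^sup>2 / 2}" "b \<in> {0<..<\<alpha> * c\<^sup>2 / 2}"
    and lams: "\<And>n. lams n \<in> {a..b}"
    and d_pos: "d > 0"
    and rs: "\<And>n. rs n \<ge> d"
    and x0: "x 0 \<in> C"
    and C0: "Cs 0 = C"
    and y_eq: "\<And>n i. i \<in> {1..M} \<Longrightarrow>
        y n i = gen_proj C (duality_map_inv (duality_map (x n) - lams n *\<^sub>R A i (x n)))"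
    and im: "\<And>n. is_arg_max (\<lambda>i. norm (y n i - x n)) (\<lambda>i. i \<in> {1..M}) (im n)"
    and ybar_eq: "\<And>n. ybar n = y n (im n)"
    and z_eq: "\<And>n j. j \<in> {1..N} \<Longrightarrow>
        z n j = duality_map_inv (\<alpha>s n *\<^sub>R duality_map (x n)
                  + (1 - \<alpha>s n) *\<^sub>R duality_map ((S j ^^ n) (ybar n)))"
    and jm: "\<And>n. is_arg_max (\<lambda>j. norm (z n j - x n)) (\<lambda>j. j \<in> {1..N}) (jm n)"
    and zbar_eq: "\<And>n. zbar n = z n (jm n)"
    and u_eq: "\<And>n k. k \<in> {1..K} \<Longrightarrow> u n k = resolvent C (f k) (rs n) (zbar n)"
    and lm: "\<And>n. is_arg_max (\<lambda>k. norm (u n k - x n)) (\<lambda>k. k \<in> {1..K}) (lm n)"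
    and ubar_eq: "\<And>n. ubar n = u n (lm n)"
    and \<epsilon>s_eq: "\<And>n. \<epsilon>s n = (ks n - 1) * (\<omega> + norm (x n))\<^sup>2"
    and Cs_Suc: "\<And>n. Cs (Suc n) = {v \<in> Cs n. lyapunov v (ubar n) \<le> lyapunov v (zbar n)
                          \<and> lyapunov v (zbar n) \<le> lyapunov v (x n) + \<epsilon>s n}"
    and x_Suc: "\<And>n. x (Suc n) = gen_proj (Cs (Suc n)) (x 0)"
  shows "x \<longlonglongrightarrow> gen_proj F (x 0)"
proof -
  obtain \<mu> where \<mu>: "\<mu> > 0" "\<And>x y :: 'a. \<mu> * (norm (x - y))\<^sup>2 + (norm ((1 / 2) *\<^sub>R (x + y)))\<^sup>2
      \<le> ((norm x)\<^sup>2 + (norm y)\<^sup>2) / 2"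
    using two_uniformly_convex_midpoint[OF uconvex] by blast
  interpret smooth_convex \<mu> "TYPE('a)"
    by unfold_locales (fact \<mu> smooth)+
  note phi_nonneg = lyapunov_nonneg[OF smooth]
  note phi_tendsto = lyapunov_tendsto[OF smooth]
  have c_pos: "0 < c" unfolding c_def by (rule two_uc_c_pos)
  \<comment> \<open>The decrease in \<open>lyapunov_VI_step\<close> made uniform in
    \<open>n\<close>: the first factor is least at \<open>a\<close>, the second at
    \<open>b\<close>.\<close>
  define \<kappa> where "\<kappa> = 2 * a * (\<alpha> - 2 * b / c\<^sup>2)"
  have "2 * b / c\<^sup>2 < \<alpha>" using ab c_pos by (simp add: pos_divide_less_eq)
  then have \<kappa>: "0 < \<kappa>" using ab by (simp add: \<kappa>_def)
  have lam: "0 < a" "a \<le> lams n" "lams n \<le> b" for n using lams[of n] ab by auto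
  have \<kappa>_le: "\<kappa> \<le> 2 * lams n * (\<alpha> - 2 * lams n / c\<^sup>2)" for n
  proof -
    have "2 * lams n / c\<^sup>2 \<le> 2 * b / c\<^sup>2" using lam c_pos by (intro divide_right_mono) auto
    then show ?thesis
      unfolding \<kappa>_def using lam(1) lam(2)[of n] lam(3)[of n] \<open>2 * b / c\<^sup>2 < \<alpha>\<close> by (intro mult_mono) auto
  qed

  have im_in: "im n \<in> {1..M}" and im_max: "i \<in> {1..M} \<Longrightarrow> norm (y n i - x n) \<le> norm (ybar n - x n)" for n i
    using im[of n] by (auto simp: is_arg_max_linorder ybar_eq)
  have jm_in: "jm n \<in> {1..N}" and jm_max: "j \<in> {1..N} \<Longrightarrow> norm (z n j - x n) \<le> norm (zbar n - x n)" for n j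
    using jm[of n] by (auto simp: is_arg_max_linorder zbar_eq)
  have lm_in: "lm n \<in> {1..K}" and lm_max: "k \<in> {1..K} \<Longrightarrow> norm (u n k - x n) \<le> norm (ubar n - x n)" for n k
    using lm[of n] by (auto simp: is_arg_max_linorder ubar_eq)
  have rs_pos: "0 < rs n" for n using rs[of n] d_pos by linarith

  \<comment> \<open>Lyapunov estimates along one iteration\<close>
  have ybar_proj: "ybar n = gen_proj C (duality_map_inv (duality_map (x n) - lams n *\<^sub>R A (im n) (x n)))" for n
    unfolding ybar_eq by (rule y_eq[OF im_in])
  have ybar_C: "ybar n \<in> C" for n
    unfolding ybar_proj by (rule gen_proj_in[OF C(2,3,1)])
  have Sn_C: "(S j ^^ n) v \<in> C" if "j \<in> {1..N}" "v \<in> C" for j n v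
    using S_self[OF that(1)] that(2) by (induction n) auto
  have A4': "convex_on C (f k v)" "lsc_on C (f k v)" if "k \<in> {1..K}" "v \<in> C" for k v
    using A4[OF that] by auto

  have F_dest: "q \<in> C" "i \<in> {1..M} \<Longrightarrow> q \<in> VI (A i) C" "j \<in> {1..N} \<Longrightarrow> q \<in> fixed_points C (S j)"
      "k \<in> {1..K} \<Longrightarrow> q \<in> EP C (f k)" "norm q \<le> \<omega>" if "q \<in> F" for q i j k
    using that F_bounded(2) unfolding F_def by auto

  have S_step: "lyapunov q ((S j ^^ n) v) \<le> ks n * lyapunov q v"
    if "q \<in> F" "j \<in> {1..N}" "v \<in> C" for q j n v
  \<comment> \<open>The asymptotic hypothesis starts at \<open>n = 1\<close>; at \<open>0\<close>
    the power is the identity and \<open>ks 0 \<ge> 1\<close> suffices.\<close>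
  proof (cases "n = 0")
    case True
    then show ?thesis using mult_right_mono[OF ks(1)[of 0] phi_nonneg[of q v]] by simp
  next
    case False
    then show ?thesis
      using S_qpan[OF that(2)] F_dest(3)[OF that(1,2)] that(3)
      unfolding quasi_phi_asymp_nonexpansive_def by simp
  qed
  let ?N = "\<lambda>n. \<kappa> * (norm (A (im n) (x n)))\<^sup>2"
  have ybar_step: "lyapunov q (ybar n) \<le> lyapunov q (x n) - ?N n" if "x n \<in> C" "q \<in> F" for q n
  proof -
    have q: "q \<in> VI (A (im n)) C" by (rule F_dest(2)[OF that(2) im_in])
    have "lyapunov q (ybar n) \<le> lyapunov q (x n)
        - 2 * lams n * (\<alpha> - 2 * lams n / c\<^sup>2) * (norm (A (im n) (x n)))\<^sup>2"
      unfolding ybar_proj c_def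
      by (rule lyapunov_VI_step[OF C(2,3) that(1) V1[OF im_in] \<alpha>_pos q V3[OF im_in that(1) q]])
        (use lam(1) lam(2)[of n] in linarith)
    moreover have "?N n \<le> 2 * lams n * (\<alpha> - 2 * lams n / c\<^sup>2) * (norm (A (im n) (x n)))\<^sup>2"
      using \<kappa>_le by (intro mult_right_mono) auto
    ultimately show ?thesis by linarith
  qed
  \<comment> \<open>The negative term is kept: it is irrelevant for membership in
    \<open>Cs (Suc n)\<close>, but later forces \<open>A (im n) (x n)\<close> to \<open>0\<close>.
    The excess caused by \<open>ks n\<close> is absorbed by \<open>\<epsilon>s n\<close>.\<close>
  have zbar_step: "lyapunov q (zbar n) \<le> lyapunov q (x n) + \<epsilon>s n - (1 - \<alpha>s n) * ?N n"
    if "x n \<in> C" "q \<in> F" for q n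
  proof -
    let ?X = "lyapunov q (x n)" and ?t = "\<alpha>s n" and ?k = "ks n"
    have t: "0 \<le> ?t" "?t \<le> 1" using \<alpha>s(1) by auto
    have k: "1 \<le> ?k" by (rule ks(1))
    have X: "0 \<le> ?X" by (rule phi_nonneg)
    have N0: "0 \<le> ?N n" using \<kappa> by simp
    have "lyapunov q (zbar n) \<le> ?t * ?X + (1 - ?t) * lyapunov q ((S (jm n) ^^ n) (ybar n))"
      unfolding zbar_eq z_eq[OF jm_in] by (rule lyapunov_J_combination[OF t])
    moreover have "(1 - ?t) * lyapunov q ((S (jm n) ^^ n) (ybar n)) \<le> (1 - ?t) * (?k * (?X - ?N n))"
    proof (rule mult_left_mono)
      have "?k * lyapunov q (ybar n) \<le> ?k * (?X - ?N n)"
        using ybar_step[OF that] k by (intro mult_left_mono) auto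
      then show "lyapunov q ((S (jm n) ^^ n) (ybar n)) \<le> ?k * (?X - ?N n)"
        using S_step[OF that(2) jm_in[of n] ybar_C[of n], of n] by linarith
    qed (use t in simp)
    moreover have "?t * ?X + (1 - ?t) * (?k * (?X - ?N n))
        = ?X + (1 - ?t) * ((?k - 1) * ?X) - (1 - ?t) * (?k * ?N n)" by algebra
    moreover have "(1 - ?t) * ((?k - 1) * ?X) \<le> 1 * ((?k - 1) * ?X)"
      using t k X by (intro mult_right_mono) auto
    moreover have "(?k - 1) * ?X \<le> \<epsilon>s n"
      unfolding \<epsilon>s_eq
    proof (rule mult_left_mono)
      have "?X \<le> (norm q + norm (x n))\<^sup>2" by (rule lyapunov_le[OF smooth])
      also have "\<dots> \<le> (\<omega> + norm (x n))\<^sup>2"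
        using F_dest(5)[OF that(2)] by (intro power_mono) auto
      finally show "?X \<le> (\<omega> + norm (x n))\<^sup>2" .
    qed (use k in simp)
    moreover have "(1 - ?t) * (1 * ?N n) \<le> (1 - ?t) * (?k * ?N n)"
      using t k N0 by (intro mult_left_mono mult_right_mono) auto
    ultimately show ?thesis by linarith
  qed
  have ubar_step: "lyapunov q (ubar n) \<le> lyapunov q (zbar n)" if "q \<in> F" for q n
    unfolding ubar_eq u_eq[OF lm_in]
    by (intro lyapunov_resolvent C A1 A2 A3 A4' rs_pos F_dest(4)[OF that]) (use lm_in in auto)

  \<comment> \<open>The claims need each other: the inclusion of \<open>F\<close> at the next index
    uses that \<open>x n\<close> lies in \<open>C\<close>, and the next projection is legitimate
    because \<open>F\<close> makes the closed convex set nonempty.\<close>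
  have inv: "closed (Cs n) \<and> convex (Cs n) \<and> Cs n \<subseteq> C \<and> F \<subseteq> Cs n \<and> x n \<in> Cs n" for n
  proof (induction n)
    case 0
    then show ?case using C C0 x0 F_dest(1) by auto
  next
    case (Suc n)
    \<comment> \<open>Two nested half-space conditions; the \<open>+ 0\<close> fits the first to
      \<open>lyapunov_halfspace\<close>.\<close>
    have eq: "Cs (Suc n) = {v \<in> {v \<in> Cs n. lyapunov v (ubar n) \<le> lyapunov v (zbar n) + 0}.
        lyapunov v (zbar n) \<le> lyapunov v (x n) + \<epsilon>s n}"
      unfolding Cs_Suc by auto
    have "closed (Cs n)" "convex (Cs n)" using Suc by auto
    note D = lyapunov_halfspace[OF this, of "ubar n" "zbar n" 0]
    have cc: "closed (Cs (Suc n))" "convex (Cs (Suc n))"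
      unfolding eq by (rule lyapunov_halfspace[OF D])+
    have "lyapunov q (zbar n) \<le> lyapunov q (x n) + \<epsilon>s n" if "q \<in> F" for q
    proof -
      have "0 \<le> (1 - \<alpha>s n) * ?N n" using \<alpha>s(1)[of n] \<kappa> by simp
      then show ?thesis using zbar_step[of n q] Suc that by auto
    qed
    then have "F \<subseteq> Cs (Suc n)" unfolding Cs_Suc using Suc ubar_step by auto
    then show ?case
      using cc F_nonempty gen_proj_in[OF cc] Suc unfolding x_Suc Cs_Suc by auto
  qed
  have x_C: "x n \<in> C" for n using inv by blast
  \<comment> \<open>At \<open>n = 0\<close> a point of \<open>C\<close> is its own projection, so
    the Pythagorean inequality holds at every index.\<close>
  have x_proj: "x n = gen_proj (Cs n) (x 0)" for n
    using gen_proj_self[OF C(2,3) x0] C0 x_Suc by (cases n) auto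
  have pyth: "lyapunov v (x n) + lyapunov (x n) (x 0) \<le> lyapunov v (x 0)" if "v \<in> Cs n" for v n
    using lyapunov_gen_proj[of "Cs n" v "x 0"] inv that by (simp flip: x_proj)
  have Cs_mono: "Cs n \<subseteq> Cs m" if "m \<le> n" for m n
    using that by (rule lift_Suc_antimono_le[of Cs, rotated]) (auto simp: Cs_Suc)
  obtain q0 where q0: "q0 \<in> F" using F_nonempty by blast
  define g where "g n = lyapunov (x n) (x 0)" for n
  have g_diff: "lyapunov (x n) (x m) \<le> g n - g m" if "m \<le> n" for m n
    using pyth[of "x n" m] Cs_mono[OF that] inv[of n] by (auto simp: g_def)
  have "incseq g"
    using g_diff phi_nonneg by (intro incseq_SucI) (meson diff_ge_0_iff_ge le_SucI order_refl order_trans)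
  moreover have "g n \<le> lyapunov q0 (x 0)" for n
    using pyth[of q0 n] inv[of n] q0 phi_nonneg[of q0 "x n"] by (auto simp: g_def)
  ultimately have "Cauchy g"
    by (metis incseq_convergent convergent_Cauchy convergentI)
  have "Cauchy x"
  proof (rule metric_CauchyI)
    fix e :: real assume e: "0 < e"
    then obtain n0 where n0: "\<And>m n. n0 \<le> m \<Longrightarrow> n0 \<le> n \<Longrightarrow> dist (g m) (g n) < 2 * \<mu> * e\<^sup>2"
      using metric_CauchyD[OF \<open>Cauchy g\<close>, of "2 * \<mu> * e\<^sup>2"] \<mu>(1) by auto
    have *: "dist (x n) (x m) < e" if "n0 \<le> m" "m \<le> n" for m n
    proof -
      have "2 * \<mu> * (norm (x n - x m))\<^sup>2 < 2 * \<mu> * e\<^sup>2"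
        using lyapunov_lower[of "x n" "x m"] g_diff[OF that(2)] n0[of n m] that
        by (simp add: dist_real_def)
      then show ?thesis using \<mu>(1) e by (simp add: dist_norm power_less_imp_less_base)
    qed
    then have "dist (x m) (x n) < e" if "n0 \<le> m" "n0 \<le> n" for m n
      using that by (metis dist_commute le_cases)
    then show "\<exists>M. \<forall>m\<ge>M. \<forall>n\<ge>M. dist (x m) (x n) < e" by blast
  qed
  then obtain p where p: "x \<longlonglongrightarrow> p" by (auto dest: Cauchy_convergent convergentD)
  have pC: "p \<in> C" using closed_sequentially[OF C(2)] x_C p by blast
  have pp: "lyapunov p p = 0" by (simp add: lyapunov_eq[OF smooth])

  \<comment> \<open>Common limit of the auxiliary sequences\<close>
  have "(\<lambda>n. (ks n - 1) * (\<omega> + norm (x n))\<^sup>2) \<longlonglongrightarrow> (1 - 1) * (\<omega> + norm p)\<^sup>2"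
    by (intro tendsto_intros ks p)
  then have \<epsilon>_lim: "\<epsilon>s \<longlonglongrightarrow> 0" by (simp add: \<epsilon>s_eq[abs_def])
  have xS: "(\<lambda>n. x (Suc n)) \<longlonglongrightarrow> p" using p by (rule LIMSEQ_Suc)
  have x_in: "lyapunov (x (Suc n)) (zbar n) \<le> lyapunov (x (Suc n)) (x n) + \<epsilon>s n"
    "lyapunov (x (Suc n)) (ubar n) \<le> lyapunov (x (Suc n)) (x n) + \<epsilon>s n" for n
    using inv[of "Suc n"] unfolding Cs_Suc by auto
  have rhs: "(\<lambda>n. lyapunov (x (Suc n)) (x n) + \<epsilon>s n) \<longlonglongrightarrow> 0"
    using tendsto_add[OF phi_tendsto[OF xS p] \<epsilon>_lim] pp by simp
  have to_p: "v \<longlonglongrightarrow> p"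
    if "\<And>n. lyapunov (x (Suc n)) (v n) \<le> lyapunov (x (Suc n)) (x n) + \<epsilon>s n" for v
  proof -
    have "(\<lambda>n. lyapunov (x (Suc n)) (v n)) \<longlonglongrightarrow> 0"
      by (rule tendsto_sandwich[OF _ _ tendsto_const rhs]) (auto simp: phi_nonneg that)
    from tendsto_diff[OF xS diff_tendsto_0_of_lyapunov[OF this]] show ?thesis by simp
  qed
  have zbar_p: "zbar \<longlonglongrightarrow> p" and ubar_p: "ubar \<longlonglongrightarrow> p" using x_in by (auto intro: to_p)
  have near_x: "w \<longlonglongrightarrow> p" if "v \<longlonglongrightarrow> p" "\<And>n. norm (w n - x n) \<le> norm (v n - x n)" for v w :: "nat \<Rightarrow> 'a"
  proof (rule tendsto_of_norm_le[OF p])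
    show "(\<lambda>n. norm (v n - x n)) \<longlonglongrightarrow> 0"
      using tendsto_norm[OF tendsto_diff[OF that(1) p]] by simp
  qed (use that in auto)
  have z_p: "(\<lambda>n. z n j) \<longlonglongrightarrow> p" if "j \<in> {1..N}" for j
    by (rule near_x[OF zbar_p jm_max[OF that]])
  have u_p: "(\<lambda>n. u n k) \<longlonglongrightarrow> p" if "k \<in> {1..K}" for k
    by (rule near_x[OF ubar_p lm_max[OF that]])

  \<comment> \<open>Finitely many \<open>\<alpha>s n\<close> may equal \<open>1\<close>; eventually
    \<open>1 - \<alpha>s n\<close> exceeds the positive constant \<open>1 - \<beta>\<close>, which
    allows division.\<close>
  obtain \<beta> where \<beta>: "limsup (\<lambda>n. ereal (\<alpha>s n)) < ereal \<beta>" "\<beta> < 1"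
    using ereal_dense2[OF \<alpha>s(2)] by auto
  have \<beta>_ev: "\<forall>\<^sub>F n in sequentially. \<alpha>s n < \<beta>"
    using Limsup_lessD[OF \<beta>(1)] by simp

  have A_lim: "(\<lambda>n. A (im n) (x n)) \<longlonglongrightarrow> 0"
  proof -
    \<comment> \<open>\<open>zbar_step\<close> solved for the negative term: both Lyapunov values
      tend to \<open>lyapunov q0 p\<close>, so their difference vanishes.\<close>
    let ?b = "\<lambda>n. (lyapunov q0 (x n) + \<epsilon>s n - lyapunov q0 (zbar n)) / ((1 - \<beta>) * \<kappa>)"
    have "?b \<longlonglongrightarrow> (lyapunov q0 p + 0 - lyapunov q0 p) / ((1 - \<beta>) * \<kappa>)"
      using \<beta>(2) \<kappa> by (intro tendsto_intros phi_tendsto p zbar_p \<epsilon>_lim) auto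
    then have b: "?b \<longlonglongrightarrow> 0" by simp
    have "(\<lambda>n. (norm (A (im n) (x n)))\<^sup>2) \<longlonglongrightarrow> 0"
    proof (rule tendsto_sandwich[OF _ _ tendsto_const b])
      show "\<forall>\<^sub>F n in sequentially. (norm (A (im n) (x n)))\<^sup>2 \<le> ?b n"
        using \<beta>_ev
      proof eventually_elim
        case (elim n)
        have "(1 - \<beta>) * ?N n \<le> (1 - \<alpha>s n) * ?N n"
          using elim \<kappa> by (intro mult_right_mono) auto
        then have "(1 - \<beta>) * ?N n \<le> lyapunov q0 (x n) + \<epsilon>s n - lyapunov q0 (zbar n)"
          using zbar_step[OF x_C q0, of n] by linarith
        then show ?case using \<beta>(2) \<kappa> by (simp add: pos_le_divide_eq ac_simps)
      qed
    qed auto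
    then show ?thesis by (simp add: tendsto_norm_zero_iff)
  qed

  have ybar_p: "ybar \<longlonglongrightarrow> p"
  proof -
    define w where "w n = duality_map_inv (duality_map (x n) - lams n *\<^sub>R A (im n) (x n))" for n
    have "(\<lambda>n. 2 / c\<^sup>2 * (b * norm (A (im n) (x n)))) \<longlonglongrightarrow> 2 / c\<^sup>2 * (b * norm (0 :: 'a \<Rightarrow>\<^sub>L real))"
      by (intro tendsto_intros A_lim)
    then have lim0: "(\<lambda>n. 2 / c\<^sup>2 * (b * norm (A (im n) (x n)))) \<longlonglongrightarrow> 0" by simp
    have w_p: "w \<longlonglongrightarrow> p"
    proof (rule tendsto_of_norm_le[OF p lim0], rule always_eventually, rule allI)
      fix n
      have "norm (w n - x n) \<le> 2 / c\<^sup>2 * (lams n * norm (A (im n) (x n)))"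
        unfolding w_def c_def using lam(1) lam(2)[of n] lam(3)[of n] by (intro J_step_close) auto
      also have "\<dots> \<le> 2 / c\<^sup>2 * (b * norm (A (im n) (x n)))"
        using lam by (intro mult_left_mono mult_right_mono) auto
      finally show "norm (w n - x n) \<le> 2 / c\<^sup>2 * (b * norm (A (im n) (x n)))" .
    qed
    \<comment> \<open>\<open>x n\<close> lies in \<open>C\<close> and so competes with the
      projection \<open>ybar n\<close> of \<open>w n\<close>; both \<open>x\<close> and
      \<open>w\<close> tend to \<open>p\<close>.\<close>
    have le: "lyapunov (ybar n) (w n) \<le> lyapunov (x n) (w n)" for n
      using lyapunov_gen_proj[OF C(2,3) x_C[of n], of "w n"] phi_nonneg[of "x n" "gen_proj C (w n)"]
      unfolding ybar_proj w_def[symmetric] by linarith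
    have lim: "(\<lambda>n. lyapunov (x n) (w n)) \<longlonglongrightarrow> 0" using phi_tendsto[OF p w_p] pp by simp
    have "(\<lambda>n. lyapunov (ybar n) (w n)) \<longlonglongrightarrow> 0"
      by (rule tendsto_sandwich[OF _ _ tendsto_const lim]) (auto simp: phi_nonneg le)
    from tendsto_add[OF diff_tendsto_0_of_lyapunov[OF this] w_p] show ?thesis by simp
  qed
  have y_p: "(\<lambda>n. y n i) \<longlonglongrightarrow> p" if "i \<in> {1..M}" for i
    by (rule near_x[OF ybar_p im_max[OF that]])

  have Sn_p: "(\<lambda>n. (S j ^^ n) (ybar n)) \<longlonglongrightarrow> p" if j: "j \<in> {1..N}" for j
  proof (rule tendsto_of_J)
    let ?b = "\<lambda>n. norm (duality_map (z n j) - duality_map (x n)) / (1 - \<beta>)"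
    have "?b \<longlonglongrightarrow> norm (duality_map p - duality_map p) / (1 - \<beta>)"
      using \<beta>(2) by (intro tendsto_intros J_tendsto z_p[OF j] p) auto
    then have b: "?b \<longlonglongrightarrow> 0" by simp
    show "(\<lambda>n. duality_map ((S j ^^ n) (ybar n))) \<longlonglongrightarrow> duality_map p"
    proof (rule tendsto_of_norm_le[OF J_tendsto[OF p] b])
      show "\<forall>\<^sub>F n in sequentially. norm (duality_map ((S j ^^ n) (ybar n)) - duality_map (x n)) \<le> ?b n"
        using \<beta>_ev
      proof eventually_elim
        case (elim n)
        let ?D = "duality_map ((S j ^^ n) (ybar n)) - duality_map (x n)"
        \<comment> \<open>The averaging is linear in dual coordinates, so the gap at
          \<open>S j\<close> is recovered from that of \<open>z n j\<close> by dividing by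
          \<open>1 - \<alpha>s n\<close>.\<close>
        have "duality_map (z n j) - duality_map (x n) = (1 - \<alpha>s n) *\<^sub>R ?D"
          by (simp add: z_eq[OF j] algebra_simps)
        then have "norm (duality_map (z n j) - duality_map (x n)) = (1 - \<alpha>s n) * norm ?D"
          using \<alpha>s(1)[of n] by simp
        moreover have "(1 - \<beta>) * norm ?D \<le> (1 - \<alpha>s n) * norm ?D"
          using elim by (intro mult_right_mono) auto
        ultimately show ?case using \<beta>(2) by (simp add: pos_le_divide_eq mult.commute)
      qed
    qed
  qed

  \<comment> \<open>Membership of the limit in \<open>F\<close> and its identification\<close>
  have "p \<in> VI (A i) C" if "i \<in> {1..M}" for i
    using VI_of_limit[OF C(2,3) V1[OF that] \<alpha>_pos x_C p y_p[OF that] y_eq[OF that] lam(1,2)] .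
  moreover have "p \<in> fixed_points C (S j)" if "j \<in> {1..N}" for j
    using fixed_point_of_asymptotic[OF S_lip[OF that] pC S_self[OF that] ybar_p ybar_C Sn_p[OF that]] pC
    by (simp add: fixed_points_def)
  moreover have "p \<in> EP C (f k)" if k: "k \<in> {1..K}" for k
  proof -
    have "(\<lambda>n. resolvent C (f k) (rs n) (zbar n)) \<longlonglongrightarrow> p" using u_p[OF k] u_eq[OF k] by simp
    then show ?thesis
      by (intro EP_of_limit[OF C(2,1) A1[OF k] A2[OF k] A3[OF k] A4'(1)[OF k] A4'(2)[OF k] d_pos rs zbar_p])
  qed
  ultimately have pF: "p \<in> F" unfolding F_def by auto

  have x0_lim: "(\<lambda>n. lyapunov (x n) (x 0)) \<longlonglongrightarrow> lyapunov p (x 0)"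
    by (intro phi_tendsto p tendsto_const)
  have F_pyth: "lyapunov q (x n) + lyapunov (x n) (x 0) \<le> lyapunov q (x 0)" if "q \<in> F" for q n
    using pyth inv[of n] that by blast
  have "gen_proj F (x 0) = p"
  proof (rule gen_proj_eqI[OF pF])
    show "lyapunov p (x 0) \<le> lyapunov q (x 0)" if "q \<in> F" for q
    proof (rule LIMSEQ_le_const2[OF x0_lim], intro exI allI impI)
      fix n show "lyapunov (x n) (x 0) \<le> lyapunov q (x 0)"
        using F_pyth[OF that, of n] phi_nonneg[of q "x n"] by linarith
    qed
    \<comment> \<open>Uniqueness from the iterates, so that convexity of \<open>F\<close> need not be established.\<close>
    fix q assume q: "q \<in> F" "\<And>w. w \<in> F \<Longrightarrow> lyapunov q (x 0) \<le> lyapunov w (x 0)"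
    have "lyapunov q p \<le> lyapunov q (x 0) - lyapunov p (x 0)"
    proof (rule LIMSEQ_le)
      show "(\<lambda>n. lyapunov q (x n)) \<longlonglongrightarrow> lyapunov q p" by (intro phi_tendsto p tendsto_const)
      show "(\<lambda>n. lyapunov q (x 0) - lyapunov (x n) (x 0)) \<longlonglongrightarrow> lyapunov q (x 0) - lyapunov p (x 0)"
        by (intro tendsto_intros x0_lim)
      show "\<exists>n0. \<forall>n\<ge>n0. lyapunov q (x n) \<le> lyapunov q (x 0) - lyapunov (x n) (x 0)"
        using F_pyth[OF q(1)] by (simp add: le_diff_eq)
    qed
    then have "2 * \<mu> * (norm (q - p))\<^sup>2 \<le> 0"
      using lyapunov_lower[of q p] q(2)[OF pF] by linarith
    then show "q = p" using \<mu>(1) by (simp add: mult_le_0_iff)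
  qed
  with p show ?thesis by simp
qed

end
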